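(* Let $\Omega\subset\mathbb{R}^N$ be a bounded open set of class $C^\infty$ and let $\beta\colon\partial\Omega\to[0,\infty)$ be smooth. Let $E_\beta\colon C(\overline\Omega)\to C_0(\mathbb{R}^N)$ be any contractive (linear) extension operator which maps an operator core $D$ for $\Delta_R$ into $D(\Delta_0)$. Then for every $u\in C(\overline\Omega)$, $$T_R(t)u=\lim_{n\to\infty}\bigl(R\,G_0(\tfrac tn)\,E_\beta\bigr)^n u\quad\text{in } C(\overline\Omega),$$ uniformly for $t\in[0,\tau]$ for every $\tau>0$.
   Context: All Laplacians are in the sense of distributions. $C_0(\mathbb{R}^N)$ is the space of continuous functions on $\mathbb{R}^N$ vanishing at infinity, with the sup norm; $C(\overline\Omega)$ carries the sup norm. $\sigma$ is the surface measure on $\partial\Omega$. Robin Laplacian $\Delta_R$ on $C(\overline\Omega)$: $D(\Delta_R)$ is the set of all $u\in H^1(\Omega)\cap C(\overline\Omega)$ with $\Delta u\in C(\overline\Omega)$ and $\int_\Omega\nabla u\cdot\nabla\varphi+\int_\Omega\Delta u\,\varphi+\int_{\partial\Omega}u\,\varphi\,\beta\,d\sigma=0$ for every $\varphi\in H^1(\Omega)$; $\Delta_R u:=\Delta u$. It is known that $\Delta_R$ generates a $C_0$-semigroup on $C(\overline\Omega)$, denoted $(T_R(t))_{t\ge0}$. An operator core for $\Delta_R$ is a subspace of $D(\Delta_R)$ that is dense in $D(\Delta_R)$ for the graph norm. $\Delta_0$ is the Laplacian on $C_0(\mathbb{R}^N)$ with $D(\Delta_0):=\{u\in C_0(\mathbb{R}^N):\Delta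 u\in C_0(\mathbb{R}^N)\}$, $\Delta_0u:=\Delta u$; it generates the Gaussian semigroup $(G_0(t))_{t\ge0}$, a positive contractive $C_0$-semigroup on $C_0(\mathbb{R}^N)$. $R\colon C_0(\mathbb{R}^N)\to C(\overline\Omega)$ is the restriction operator. A linear operator $E\colon C(\overline\Omega)\to C_0(\mathbb{R}^N)$ is an extension operator if $RE=I$, and contractive if $\|Eu\|_\infty\le\|u\|_\infty$ for all $u$. *)

theory Defs
  imports "HOL-Analysis.Analysis"
begin

definition partial_deriv :: "'a::euclidean_space \<Rightarrow> ('a \<Rightarrow> real) \<Rightarrow> 'a \<Rightarrow> real" where
  "partial_deriv b f x = frechet_derivative f (at x) b"

text \<open>Only used for open \<open>S\<close>.\<close>

primrec Ck_on :: "nat \<Rightarrow> 'a::euclidean_space set \<Rightarrow> ('a \<Rightarrow> real) \<Rightarrow> bool" where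
  "Ck_on 0 S f \<longleftrightarrow> continuous_on S f"
| "Ck_on (Suc k) S f \<longleftrightarrow>
     (\<forall>x\<in>S. f differentiable (at x)) \<and> (\<forall>b\<in>Basis. Ck_on k S (partial_deriv b f))"

definition smooth_on :: "'a::euclidean_space set \<Rightarrow> ('a \<Rightarrow> real) \<Rightarrow> bool" where
  "smooth_on S f \<longleftrightarrow> (\<forall>k. Ck_on k S f)"

definition test_fun :: "'a::euclidean_space set \<Rightarrow> ('a \<Rightarrow> real) set" where
  "test_fun \<Omega> = {\<phi>. smooth_on UNIV \<phi> \<and> compact (closure {x. \<phi> x \<noteq> 0}) \<and> closure {x. \<phi> x \<noteq> 0} \<subseteq> \<Omega>}"

text \<open>
  Near each boundary point the set is, in suitable orthonormal coordinates with last axis \<open>e\<close>, the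
  part of a ball lying strictly above the graph of a smooth function \<open>h\<close> of the other coordinates.
  Such an \<open>h\<close> is a function on the hyperplane orthogonal to \<open>e\<close>; here it is extended to the
  whole space (for example constantly along \<open>e\<close>) and evaluated only on that hyperplane.
\<close>

definition smooth_boundary :: "'a::euclidean_space set \<Rightarrow> bool" where
  "smooth_boundary \<Omega> \<longleftrightarrow>
     (\<forall>z\<in>frontier \<Omega>. \<exists>r>0. \<exists>e h. norm e = 1 \<and> smooth_on UNIV h \<and>
        \<Omega> \<inter> ball z r = {x \<in> ball z r. x \<bullet> e > h (x - (x \<bullet> e) *\<^sub>R e)})"

text \<open>Smoothness on a set that need not be open, such as the hypersurface \<open>frontier \<Omega>\<close>: locally
  the restriction of a smooth function.\<close>

definition smooth_on_subset :: "'a::euclidean_space set \<Rightarrow> ('a \<Rightarrow> real) \<Rightarrow> bool" where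
  "smooth_on_subset S f \<longleftrightarrow>
     (\<forall>z\<in>S. \<exists>U g. open U \<and> z \<in> U \<and> smooth_on U g \<and> (\<forall>x\<in>S \<inter> U. f x = g x))"

text \<open>
  The \<open>s\<close>-dimensional Hausdorff measure, normalised so that for \<open>s = DIM('a) - 1\<close> it is the usual
  surface measure on hypersurfaces (for \<open>s = 0\<close> it is counting measure: \<open>0 ^ 0 = 1\<close>, whence the
  separate treatment of empty covering sets). By Caratheodory's criterion the outer measure
  is countably additive on Borel sets, so \<open>measure_of\<close> below is not the degenerate
  zero measure.
\<close>

definition hausdorff_premeasure :: "nat \<Rightarrow> real \<Rightarrow> 'a::euclidean_space set \<Rightarrow> ennreal" where
  "hausdorff_premeasure s \<delta> A =
     (INF C \<in> {C :: nat \<Rightarrow> 'a set. A \<subseteq> (\<Union>i. C i) \<and> (\<forall>i. bounded (C i) \<and> diameter (C i) \<le> \<delta>)}.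
        \<Sum>i. if C i = {} then 0
             else ennreal (unit_ball_vol (real s) * (diameter (C i) / 2) ^ s))"

definition hausdorff_outer :: "nat \<Rightarrow> 'a::euclidean_space set \<Rightarrow> ennreal" where
  "hausdorff_outer s A = (SUP \<delta>\<in>{0<..}. hausdorff_premeasure s \<delta> A)"

definition surface_measure :: "'a::euclidean_space set \<Rightarrow> 'a measure" where
  "surface_measure \<Omega> =
     restrict_space (measure_of UNIV (sets borel) (hausdorff_outer (DIM('a) - 1))) (frontier \<Omega>)"

definition laplacian :: "('a::euclidean_space \<Rightarrow> real) \<Rightarrow> 'a \<Rightarrow> real" where
  "laplacian \<phi> x = (\<Sum>b\<in>Basis. partial_deriv b (partial_deriv b \<phi>) x)"

text \<open>\<open>\<Delta>u = f\<close> in the sense of distributions on the open set \<open>\<Omega>\<close>; only used for \<open>u\<close>, \<open>f\<close>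
  continuous on \<open>\<Omega>\<close>, so that the integrals exist.\<close>

definition distr_laplacian ::
  "'a::euclidean_space set \<Rightarrow> ('a \<Rightarrow> real) \<Rightarrow> ('a \<Rightarrow> real) \<Rightarrow> bool" where
  "distr_laplacian \<Omega> u f \<longleftrightarrow>
     (\<forall>\<phi>\<in>test_fun \<Omega>. (\<integral>x. u x * laplacian \<phi> x \<partial>lebesgue_on \<Omega>) = (\<integral>x. f x * \<phi> x \<partial>lebesgue_on \<Omega>))"

definition L2 :: "'a measure \<Rightarrow> ('a \<Rightarrow> 'b::euclidean_space) set" where
  "L2 M = {u \<in> borel_measurable M. integrable M (\<lambda>x. (norm (u x))\<^sup>2)}"

definition is_weak_gradient ::
  "'a::euclidean_space set \<Rightarrow> ('a \<Rightarrow> real) \<Rightarrow> ('a \<Rightarrow> 'a) \<Rightarrow> bool" where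
  "is_weak_gradient \<Omega> u g \<longleftrightarrow>
     (\<forall>\<phi>\<in>test_fun \<Omega>. \<forall>b\<in>Basis.
        (\<integral>x. u x * partial_deriv b \<phi> x \<partial>lebesgue_on \<Omega>) = - (\<integral>x. (g x \<bullet> b) * \<phi> x \<partial>lebesgue_on \<Omega>))"

text \<open>\<open>H\<^sup>1(\<Omega>)\<close>, as a set of functions rather than of classes modulo null sets.\<close>

definition H1 :: "'a::euclidean_space set \<Rightarrow> ('a \<Rightarrow> real) set" where
  "H1 \<Omega> = {u \<in> L2 (lebesgue_on \<Omega>). \<exists>g \<in> L2 (lebesgue_on \<Omega>). is_weak_gradient \<Omega> u g}"

text \<open>Determined almost everywhere for \<open>u \<in> H1 \<Omega>\<close>.\<close>

definition weak_gradient :: "'a::euclidean_space set \<Rightarrow> ('a \<Rightarrow> real) \<Rightarrow> 'a \<Rightarrow> 'a" where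
  "weak_gradient \<Omega> u = (SOME g. g \<in> L2 (lebesgue_on \<Omega>) \<and> is_weak_gradient \<Omega> u g)"

definition H1_norm :: "'a::euclidean_space set \<Rightarrow> ('a \<Rightarrow> real) \<Rightarrow> real" where
  "H1_norm \<Omega> u = sqrt ((\<integral>x. (u x)\<^sup>2 \<partial>lebesgue_on \<Omega>) +
                        (\<integral>x. (norm (weak_gradient \<Omega> u x))\<^sup>2 \<partial>lebesgue_on \<Omega>))"

text \<open>
  The trace operator is the continuous extension to \<open>H1 \<Omega>\<close> of the map restricting a function
  smooth up to the boundary to \<open>frontier \<Omega>\<close>. For bounded open sets with smooth boundary the trace
  exists for every \<open>\<phi> \<in> H1 \<Omega>\<close> and is unique up to null sets of the surface measure, so the
  integrals in which it occurs do not depend on the choice.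
\<close>

definition is_trace :: "'a::euclidean_space set \<Rightarrow> ('a \<Rightarrow> real) \<Rightarrow> ('a \<Rightarrow> real) \<Rightarrow> bool" where
  "is_trace \<Omega> \<phi> g \<longleftrightarrow>
     g \<in> L2 (surface_measure \<Omega>) \<and>
     (\<exists>v :: nat \<Rightarrow> 'a \<Rightarrow> real. (\<forall>n. smooth_on UNIV (v n)) \<and>
        (\<lambda>n. H1_norm \<Omega> (\<lambda>x. v n x - \<phi> x)) \<longlonglongrightarrow> 0 \<and>
        (\<lambda>n. \<integral>x. (v n x - g x)\<^sup>2 \<partial>surface_measure \<Omega>) \<longlonglongrightarrow> 0)"

definition trace_op :: "'a::euclidean_space set \<Rightarrow> ('a \<Rightarrow> real) \<Rightarrow> 'a \<Rightarrow> real" where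
  "trace_op \<Omega> \<phi> = (SOME g. is_trace \<Omega> \<phi> g)"

text \<open>
  An element of \<open>C(closure \<Omega>)\<close> is represented by its extension by zero to the whole space, so
  that equality of elements is equality of functions and both function spaces share one sup norm.
\<close>

definition C_closure :: "'a::euclidean_space set \<Rightarrow> ('a \<Rightarrow> real) set" where
  "C_closure \<Omega> = {u. continuous_on (closure \<Omega>) u \<and> (\<forall>x. x \<notin> closure \<Omega> \<longrightarrow> u x = 0)}"

definition C_0 :: "('a::euclidean_space \<Rightarrow> real) set" where
  "C_0 = {u. continuous_on UNIV u \<and> (u \<longlongrightarrow> 0) at_infinity}"

definition sup_norm :: "('a \<Rightarrow> real) \<Rightarrow> real" where
  "sup_norm u = (SUP x. \<bar>u x\<bar>)"

definition restriction :: "'a::euclidean_space set \<Rightarrow> ('a \<Rightarrow> real) \<Rightarrow> 'a \<Rightarrow> real" where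
  "restriction \<Omega> u x = (if x \<in> closure \<Omega> then u x else 0)"

definition linear_op_on :: "('a \<Rightarrow> real) set \<Rightarrow> (('a \<Rightarrow> real) \<Rightarrow> 'b \<Rightarrow> real) \<Rightarrow> bool" where
  "linear_op_on X L \<longleftrightarrow>
     (\<forall>u\<in>X. \<forall>v\<in>X. \<forall>a b. L (\<lambda>x. a * u x + b * v x) = (\<lambda>x. a * L u x + b * L v x))"

definition contractive_extension_op ::
  "'a::euclidean_space set \<Rightarrow> (('a \<Rightarrow> real) \<Rightarrow> 'a \<Rightarrow> real) \<Rightarrow> bool" where
  "contractive_extension_op \<Omega> E \<longleftrightarrow>
     E ` C_closure \<Omega> \<subseteq> C_0 \<and> linear_op_on (C_closure \<Omega>) E \<and>
     (\<forall>u\<in>C_closure \<Omega>. restriction \<Omega> (E u) = u) \<and>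
     (\<forall>u\<in>C_closure \<Omega>. sup_norm (E u) \<le> sup_norm u)"

text \<open>\<open>X\<close> is a space of bounded functions with the sup norm; unbounded operators on \<open>X\<close> are
  identified with their graphs.\<close>

definition C0_semigroup ::
  "('a \<Rightarrow> real) set \<Rightarrow> (real \<Rightarrow> ('a \<Rightarrow> real) \<Rightarrow> 'a \<Rightarrow> real) \<Rightarrow> bool" where
  "C0_semigroup X T \<longleftrightarrow>
     (\<forall>t\<ge>0. T t ` X \<subseteq> X \<and> linear_op_on X (T t) \<and>
        (\<exists>M. \<forall>u\<in>X. sup_norm (T t u) \<le> M * sup_norm u)) \<and>
     (\<forall>u\<in>X. T 0 u = u) \<and>
     (\<forall>s\<ge>0. \<forall>t\<ge>0. \<forall>u\<in>X. T (s + t) u = T s (T t u)) \<and>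
     (\<forall>u\<in>X. ((\<lambda>t. sup_norm (\<lambda>x. T t u x - u x)) \<longlongrightarrow> 0) (at_right 0))"

definition generator ::
  "('a \<Rightarrow> real) set \<Rightarrow> (real \<Rightarrow> ('a \<Rightarrow> real) \<Rightarrow> 'a \<Rightarrow> real) \<Rightarrow> (('a \<Rightarrow> real) \<times> ('a \<Rightarrow> real)) set" where
  "generator X T =
     {(u, f). u \<in> X \<and> f \<in> X \<and>
        ((\<lambda>t. sup_norm (\<lambda>x. (T t u x - u x) / t - f x)) \<longlongrightarrow> 0) (at_right 0)}"

definition operator_core ::
  "(('a \<Rightarrow> real) \<times> ('a \<Rightarrow> real)) set \<Rightarrow> ('a \<Rightarrow> real) set \<Rightarrow> bool" where
  "operator_core A D \<longleftrightarrow>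
     D \<subseteq> Domain A \<and> (\<lambda>x. 0) \<in> D \<and>
     (\<forall>u\<in>D. \<forall>v\<in>D. \<forall>a b. (\<lambda>x. a * u x + b * v x) \<in> D) \<and>
     (\<forall>(u, f)\<in>A. \<forall>\<epsilon>>0. \<exists>(v, g)\<in>A. v \<in> D \<and>
        sup_norm (\<lambda>x. u x - v x) + sup_norm (\<lambda>x. f x - g x) < \<epsilon>)"

definition robin_laplacian ::
  "'a::euclidean_space set \<Rightarrow> ('a \<Rightarrow> real) \<Rightarrow> (('a \<Rightarrow> real) \<times> ('a \<Rightarrow> real)) set" where
  "robin_laplacian \<Omega> \<beta> =
     {(u, f). u \<in> H1 \<Omega> \<inter> C_closure \<Omega> \<and> f \<in> C_closure \<Omega> \<and> distr_laplacian \<Omega> u f \<and>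
        (\<forall>\<phi>\<in>H1 \<Omega>.
           (\<integral>x. weak_gradient \<Omega> u x \<bullet> weak_gradient \<Omega> \<phi> x \<partial>lebesgue_on \<Omega>)
           + (\<integral>x. f x * \<phi> x \<partial>lebesgue_on \<Omega>)
           + (\<integral>x. u x * trace_op \<Omega> \<phi> x * \<beta> x \<partial>surface_measure \<Omega>) = 0)}"

definition laplacian_C0 :: "(('a::euclidean_space \<Rightarrow> real) \<times> ('a \<Rightarrow> real)) set" where
  "laplacian_C0 = {(u, f). u \<in> C_0 \<and> f \<in> C_0 \<and> distr_laplacian UNIV u f}"

definition gaussian_semigroup ::
  "real \<Rightarrow> ('a::euclidean_space \<Rightarrow> real) \<Rightarrow> 'a \<Rightarrow> real" where
  "gaussian_semigroup t u x =
     (if t > 0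
      then (4 * pi * t) powr (- (real DIM('a) / 2)) *
           (\<integral>y. exp (- (norm (x - y))\<^sup>2 / (4 * t)) * u y \<partial>lebesgue)
      else u x)"

end

theory Submission
  imports Defs "HOL-Probability.Distributions"
begin

text \<open>
  The theorem is an instance of Chernoff's product formula. On \<open>C(closure \<Omega>)\<close> the operators
  \<open>F(h) = R G\<^sub>0(h) E\<^sub>\<beta>\<close> are contractions, and the claim is that \<open>F(t/n)\<^sup>n u\<close> tends to \<open>T\<^sub>R(t) u\<close>
  locally uniformly in \<open>t\<close>. For this it suffices that \<open>(F(h) v - v) / h\<close> tends to \<open>\<Delta>v\<close> for all
  \<open>v\<close> in the core \<open>D\<close>.

  Chernoff's formula (\<open>chernoff_formula\<close>) is obtained by comparing orbits. Put
  \<open>A\<^sub>h = (F(h) - I) / h\<close>. The resolvents \<open>K\<^sub>h = (I - A\<^sub>h)\<inverse>\<close> are contractions, and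
  \<open>K\<^sub>h (x - A x)\<close> tends to \<open>x\<close> for every \<open>x\<close> in the domain of the generator \<open>A\<close>: first on the
  core, then on the whole domain, since the \<open>K\<^sub>h\<close> are equicontinuous. For \<open>u\<close> in the domain of \<open>A\<^sup>2\<close>, the
  curve \<open>X(s) = K\<^sub>h T(s) (u - A u)\<close> is close to \<open>T(s) u\<close> and satisfies
  \<open>X(s + h) = F(h) X(s) + o(h)\<close> uniformly for \<open>s\<close> in a compact interval, so a telescoping
  estimate shows that \<open>F(h)\<^sup>n u\<close> is close to \<open>T(n h) u\<close>. The domain of \<open>A\<^sup>2\<close> is dense. Local
  boundedness of the semigroup, needed throughout, comes from the uniform boundedness principle.

  The convergence on the core is a statement about the Gaussian semigroup. Let \<open>w = E\<^sub>\<beta> v\<close> and let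
  \<open>g\<close> be its distributional Laplacian. Testing \<open>\<Delta>w = g\<close> with Gaussians that are cut off smoothly
  gives \<open>d/dt G\<^sub>0(t) w = G\<^sub>0(t) g\<close> pointwise (\<open>gaussian_semigroup_DERIV\<close>). By the mean value
  theorem, \<open>(G\<^sub>0(t) w - w) / t\<close> at \<open>x\<close> is the value of \<open>G\<^sub>0(\<xi>) g\<close> at \<open>x\<close> for some \<open>\<xi>\<close> between
  \<open>0\<close> and \<open>t\<close>, and this tends to \<open>g\<close> uniformly on compact sets
  (\<open>gaussian_semigroup_generator\<close>). Since \<open>w = v\<close> on \<open>closure \<Omega>\<close>, the functions \<open>g\<close> and
  \<open>\<Delta>v\<close> agree there (\<open>distr_laplacian_unique\<close>).

  Chernoff's formula is proved in Banach spaces given as types. To apply it, \<open>C(closure \<Omega>)\<close> is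
  identified with its image under \<open>E\<^sub>\<beta>\<close>, which is isometric, in the Banach space of all bounded
  continuous functions on the whole space. There \<open>E\<^sub>\<beta> T\<^sub>R(t) R\<close> is a semigroup whose value at time
  \<open>0\<close> is the projection \<open>E\<^sub>\<beta> R\<close> instead of the identity.
\<close>

section \<open>Strongly continuous semigroups and Chernoff's product formula\<close>

text \<open>The uniform boundedness principle for sequences of operators, by Baire's theorem.\<close>

lemma uniform_boundedness:
  fixes f :: "nat \<Rightarrow> 'b::banach \<Rightarrow> 'c::real_normed_vector"
  assumes lin: "\<And>n. bounded_linear (f n)" and pw: "\<And>x. \<exists>B. \<forall>n. norm (f n x) \<le> B"
  shows "\<exists>M. \<forall>n x. norm (f n x) \<le> M * norm x"
proof -
  define C where "C k = {x. \<forall>n. norm (f n x) \<le> real k}" for k :: nat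
  have closed_C: "closed (C k)" for k
  proof -
    have "C k = (\<Inter>n. {x. norm (f n x) \<le> real k})" by (auto simp: C_def)
    moreover have "closed {x. norm (f n x) \<le> real k}" for n
      by (intro closed_Collect_le continuous_intros linear_continuous_on lin)
    ultimately show ?thesis by auto
  qed
  have UC: "\<Union>(range C) = UNIV"
  proof -
    have "\<exists>k. x \<in> C k" for x
    proof -
      obtain B where B: "\<forall>n. norm (f n x) \<le> B" using pw by blast
      obtain k :: nat where "B \<le> real k" using real_arch_simple by blast
      then have "x \<in> C k" using B order_trans by (fastforce simp: C_def)
      then show ?thesis ..
    qed
    then show ?thesis by auto
  qed
  have "\<exists>k. interior (C k) \<noteq> {}"
  proof (rule ccontr)
    assume "\<not> ?thesis"
    then have "Met_TC.mtopology interior_of \<Union>(range C) = {}"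
      using closed_C complete_UNIV
      by (intro Met_TC.metric_Baire_category_alt) auto
    then show False by (simp add: UC)
  qed
  then obtain k x0 r where r: "r > 0" "ball x0 r \<subseteq> C k"
    by (metis all_not_in_conv mem_interior)
  have "norm (f n x) \<le> (4 * real k / r) * norm x" for n x
  proof (cases "x = 0")
    case True
    then show ?thesis using lin[of n] by (simp add: linear_simps)
  next
    case False
    define c where "c = r / (2 * norm x)"
    have c: "c > 0" using False r by (simp add: c_def)
    have "x0 \<in> C k" "x0 + c *\<^sub>R x \<in> C k"
      using r False by (auto intro!: subsetD[OF r(2)] simp: dist_norm c_def)
    then have "norm (f n x0) \<le> real k" "norm (f n (x0 + c *\<^sub>R x)) \<le> real k"
      by (auto simp: C_def)
    moreover have "f n (x0 + c *\<^sub>R x) = f n x0 + c *\<^sub>R f n x"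
      using lin[of n] by (simp add: linear_simps)
    ultimately have "norm (c *\<^sub>R f n x) \<le> 2 * real k"
      by (metis (no_types, opaque_lifting) add_diff_cancel_left' add_mono mult_2 norm_triangle_ineq4 order_trans)
    then have "c * norm (f n x) \<le> 2 * real k" using c by simp
    then have "norm (f n x) \<le> 2 * real k / c" using c by (simp add: field_simps)
    also have "\<dots> = (4 * real k / r) * norm x" by (simp add: c_def)
    finally show ?thesis .
  qed
  then show ?thesis by blast
qed

text \<open>
  A strongly continuous semigroup of bounded operators that need not start at the identity:
  \<open>T 0\<close> is a projection, and \<open>T\<close> is an ordinary \<open>C\<^sub>0\<close>-semigroup on the closed subspace
  \<open>{x. T 0 x = x}\<close>.
\<close>

locale degenerate_semigroup =
  fixes T :: "real \<Rightarrow> 'b::banach \<Rightarrow> 'b"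
  assumes lin: "\<And>t. t \<ge> 0 \<Longrightarrow> bounded_linear (T t)"
    and add: "\<And>s t x. s \<ge> 0 \<Longrightarrow> t \<ge> 0 \<Longrightarrow> T (s + t) x = T s (T t x)"
    and right0: "\<And>x. ((\<lambda>h. T h x) \<longlongrightarrow> T 0 x) (at_right 0)"
begin

text \<open>The generator on the subspace \<open>{x. T 0 x = x}\<close>, given by its graph.\<close>

definition gen :: "('b \<times> 'b) set" where
  "gen = {(x, y). T 0 x = x \<and> ((\<lambda>h. (T h x - x) /\<^sub>R h) \<longlongrightarrow> y) (at_right 0)}"

lemma T_0 [simp]: "t \<ge> 0 \<Longrightarrow> T t (T 0 x) = T t x" "t \<ge> 0 \<Longrightarrow> T 0 (T t x) = T t x"
  using add[of t 0 x] add[of 0 t x] by auto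

lemma T_linear: "t \<ge> 0 \<Longrightarrow> T t (x + y) = T t x + T t y"
  "t \<ge> 0 \<Longrightarrow> T t (x - y) = T t x - T t y"
  "t \<ge> 0 \<Longrightarrow> T t (c *\<^sub>R x) = c *\<^sub>R T t x"
  using lin by (auto simp: linear_simps)

lemma bounded_near_0: "\<exists>\<delta>>0. \<exists>M\<ge>1. \<forall>s\<in>{0..\<delta>}. \<forall>x. norm (T s x) \<le> M * norm x"
proof (rule ccontr)
  assume neg: "\<not> ?thesis"
  have "\<exists>s x. s \<in> {0..inverse (real (Suc n))} \<and> norm (T s x) > real (Suc n) * norm x" for n
  proof -
    have "\<not> (\<forall>s\<in>{0..inverse (real (Suc n))}. \<forall>x. norm (T s x) \<le> real (Suc n) * norm x)"
    proof
      assume a: "\<forall>s\<in>{0..inverse (real (Suc n))}. \<forall>x. norm (T s x) \<le> real (Suc n) * norm x"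
      have "inverse (real (Suc n)) > 0" "real (Suc n) \<ge> 1" by auto
      with a neg show False by blast
    qed
    then show ?thesis by (auto simp: not_le)
  qed
  then obtain s x where s: "\<And>n. s n \<in> {0..inverse (real (Suc n))}"
    and big: "\<And>n. norm (T (s n) (x n)) > real (Suc n) * norm (x n)"
    by metis
  have s0: "s \<longlonglongrightarrow> 0"
    by (rule tendsto_sandwich[OF _ _ tendsto_const LIMSEQ_inverse_real_of_nat])
       (use s in \<open>auto simp: eventually_sequentially\<close>)
  have "\<exists>B. \<forall>n. norm (T (s n) y) \<le> B" for y
  proof -
    have cont: "continuous (at 0 within {0..}) (\<lambda>h. T h y)"
      using right0[of y] by (simp add: continuous_within at_within_Ici_at_right)
    have "(\<lambda>n. T (s n) y) \<longlonglongrightarrow> T 0 y"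
      using cont s s0 by (auto simp: continuous_within_sequentially o_def)
    then have "Bseq (\<lambda>n. T (s n) y)" by (rule convergent_imp_Bseq[OF convergentI])
    then show ?thesis by (auto simp: Bseq_def)
  qed
  moreover have "bounded_linear (T (s n))" for n using s lin by auto
  ultimately obtain M where M: "\<And>n x. norm (T (s n) x) \<le> M * norm x"
    using uniform_boundedness[of "\<lambda>n. T (s n)"] by metis
  obtain n where "M \<le> real n" using real_arch_simple by blast
  then have "M * norm (x n) \<le> real (Suc n) * norm (x n)" by (intro mult_right_mono) auto
  then show False using M[of n "x n"] big[of n] by linarith
qed

lemma bounded_on_interval: "\<exists>M\<ge>1. \<forall>s\<in>{0..\<tau>}. \<forall>x. norm (T s x) \<le> M * norm x"
proof -
  obtain \<delta> M where d: "\<delta> > 0" "M \<ge> 1" "\<And>s x. s \<in> {0..\<delta>} \<Longrightarrow> norm (T s x) \<le> M * norm x"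
    using bounded_near_0 by blast
  have *: "norm (T s x) \<le> M ^ Suc n * norm x" if "s \<in> {0..real (Suc n) * \<delta>}" for s x n
    using that
  proof (induction n arbitrary: s x)
    case 0
    then show ?case using d by simp
  next
    case (Suc n)
    define s' where "s' = max 0 (s - \<delta>)"
    have s': "s' \<in> {0..real (Suc n) * \<delta>}" "s - s' \<in> {0..\<delta>}"
      using Suc.prems d(1) by (auto simp: s'_def max_def algebra_simps)
    have "T s x = T s' (T (s - s') x)" using add[of s' "s - s'" x] s' by auto
    then have "norm (T s x) \<le> M ^ Suc n * norm (T (s - s') x)" using Suc.IH[OF s'(1)] by simp
    also have "\<dots> \<le> M ^ Suc n * (M * norm x)"
      using d s' by (intro mult_left_mono) auto
    finally show ?case by (simp add: algebra_simps)
  qed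
  obtain n where "\<tau> / \<delta> \<le> real n" using real_arch_simple by blast
  then have "\<tau> \<le> real n * \<delta>" using d by (simp add: field_simps)
  also have "\<dots> \<le> real (Suc n) * \<delta>" using d by simp
  finally have "\<forall>s\<in>{0..\<tau>}. \<forall>x. norm (T s x) \<le> M ^ Suc n * norm x" using * by auto
  moreover have "M ^ Suc n \<ge> 1" using d(2) by (rule one_le_power)
  ultimately show ?thesis by blast
qed

lemma continuous_on_orbit: "continuous_on {0..\<tau>} (\<lambda>s. T s x)"
proof (cases "\<tau> \<ge> 0")
  case True
  obtain M where M: "M \<ge> 1" "\<And>s x. s \<in> {0..\<tau>} \<Longrightarrow> norm (T s x) \<le> M * norm x"
    using bounded_on_interval by blast
  show ?thesis
  proof (intro continuous_onI)
    fix s e :: real assume s: "s \<in> {0..\<tau>}" and e: "e > 0"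
    have "\<forall>\<^sub>F h in at_right 0. dist (T h x) (T 0 x) < e / M"
      using right0 M e by (intro tendstoD) auto
    then obtain d where d: "d > 0" "\<And>h. 0 < h \<Longrightarrow> h < d \<Longrightarrow> dist (T h x) (T 0 x) < e / M"
      by (auto simp: eventually_at_right_field)
    have *: "norm (T (p + h) x - T p x) \<le> e" if "p \<in> {0..\<tau>}" "0 \<le> h" "h < d" for p h
    proof -
      have "T (p + h) x - T p x = T p (T h x - T 0 x)"
        using that by (simp add: add T_linear)
      also have "norm \<dots> \<le> M * norm (T h x - T 0 x)" using M that by auto
      also have "\<dots> \<le> M * (e / M)"
      proof (intro mult_left_mono)
        show "norm (T h x - T 0 x) \<le> e / M"
          using d(2)[of h] that M e by (cases "h = 0") (auto simp: dist_norm)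
      qed (use M in auto)
      finally show ?thesis using M by simp
    qed
    show "\<exists>d>0. \<forall>x'\<in>{0..\<tau>}. dist x' s < d \<longrightarrow> dist (T x' x) (T s x) \<le> e"
    proof (intro exI[of _ d] conjI d ballI impI)
      fix p assume p: "p \<in> {0..\<tau>}" "dist p s < d"
      show "dist (T p x) (T s x) \<le> e"
        using *[of s "p - s"] *[of p "s - p"] p s
        by (cases "s \<le> p") (auto simp: dist_norm norm_minus_commute)
    qed
  qed
qed auto

lemma gen_add:
  assumes "(x, y) \<in> gen" "(x', y') \<in> gen"
  shows "(x + x', y + y') \<in> gen"
proof -
  have "((\<lambda>h. (T h x - x) /\<^sub>R h + (T h x' - x') /\<^sub>R h) \<longlongrightarrow> y + y') (at_right 0)"
    using assms by (auto simp: gen_def intro: tendsto_add)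
  then have "((\<lambda>h. (T h (x + x') - (x + x')) /\<^sub>R h) \<longlongrightarrow> y + y') (at_right 0)"
    by (rule Lim_transform_eventually)
       (auto simp: eventually_at_right_field T_linear algebra_simps intro!: exI[of _ 1])
  then show ?thesis using assms by (simp add: gen_def T_linear)
qed

lemma gen_scale:
  assumes "(x, y) \<in> gen"
  shows "(c *\<^sub>R x, c *\<^sub>R y) \<in> gen"
proof -
  have "((\<lambda>h. c *\<^sub>R ((T h x - x) /\<^sub>R h)) \<longlongrightarrow> c *\<^sub>R y) (at_right 0)"
    using assms unfolding gen_def by (intro tendsto_scaleR[OF tendsto_const]) blast
  then have "((\<lambda>h. (T h (c *\<^sub>R x) - c *\<^sub>R x) /\<^sub>R h) \<longlongrightarrow> c *\<^sub>R y) (at_right 0)"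
    by (rule Lim_transform_eventually)
       (auto simp: eventually_at_right_field T_linear algebra_simps intro!: exI[of _ 1])
  then show ?thesis using assms by (simp add: gen_def T_linear)
qed

lemma gen_diff: "(x, y) \<in> gen \<Longrightarrow> (x', y') \<in> gen \<Longrightarrow> (x - x', y - y') \<in> gen"
  using gen_add[of x y "(- 1) *\<^sub>R x'" "(- 1) *\<^sub>R y'"] gen_scale[of x' y' "- 1"] by simp

lemma gen_semigroup:
  assumes "(x, y) \<in> gen" "s \<ge> 0"
  shows "(T s x, T s y) \<in> gen"
proof -
  have "((\<lambda>h. T s ((T h x - x) /\<^sub>R h)) \<longlongrightarrow> T s y) (at_right 0)"
    using assms by (auto simp: gen_def intro: bounded_linear.tendsto[OF lin])
  then have "((\<lambda>h. (T h (T s x) - T s x) /\<^sub>R h) \<longlongrightarrow> T s y) (at_right 0)"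
    by (rule Lim_transform_eventually)
       (auto simp: eventually_at_right_field T_linear assms add[symmetric] add.commute intro!: exI[of _ 1])
  then show ?thesis using assms by (simp add: gen_def T_linear)
qed

lemma gen_range:
  assumes "(x, y) \<in> gen"
  shows "T 0 y = y"
proof (rule tendsto_unique)
  have l: "((\<lambda>h. (T h x - x) /\<^sub>R h) \<longlongrightarrow> y) (at_right 0)" and x: "T 0 x = x"
    using assms by (auto simp: gen_def)
  then have "((\<lambda>h. T 0 ((T h x - x) /\<^sub>R h)) \<longlongrightarrow> T 0 y) (at_right 0)"
    by (intro bounded_linear.tendsto[OF lin]) auto
  then show "((\<lambda>h. (T h x - x) /\<^sub>R h) \<longlongrightarrow> T 0 y) (at_right 0)"
    by (rule Lim_transform_eventually)
       (auto simp: eventually_at_right_field T_linear x intro!: exI[of _ 1])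
  show "((\<lambda>h. (T h x - x) /\<^sub>R h) \<longlongrightarrow> y) (at_right 0)" by (fact l)
qed auto

text \<open>The integral of an orbit; \<open>orbit_int \<delta> x /\<^sub>R \<delta>\<close> lies in the domain of the generator and tends to
  \<open>T 0 x\<close> as \<open>\<delta> \<rightarrow> 0\<close>.\<close>

definition orbit_int :: "real \<Rightarrow> 'b \<Rightarrow> 'b" where
  "orbit_int \<delta> x = integral {0..\<delta>} (\<lambda>s. T s x)"

lemma orbit_integrable: "0 \<le> a \<Longrightarrow> (\<lambda>s. T s x) integrable_on {a..b}"
  by (intro integrable_continuous_real continuous_on_subset[OF continuous_on_orbit[of b]]) auto

lemma bounded_linear_orbit_int:
  assumes "\<delta> \<ge> 0"
  shows "bounded_linear (orbit_int \<delta>)"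
proof -
  obtain M where M: "\<And>s x. s \<in> {0..\<delta>} \<Longrightarrow> norm (T s x) \<le> M * norm x"
    using bounded_on_interval by blast
  show ?thesis
  proof (rule bounded_linear_intro)
    fix x y and r :: real
    have "integral {0..\<delta>} (\<lambda>s. T s (x + y)) = integral {0..\<delta>} (\<lambda>s. T s x + T s y)"
      by (rule integral_cong) (auto simp: T_linear)
    then show "orbit_int \<delta> (x + y) = orbit_int \<delta> x + orbit_int \<delta> y"
      unfolding orbit_int_def by (simp add: integral_add orbit_integrable)
    have "integral {0..\<delta>} (\<lambda>s. T s (r *\<^sub>R x)) = integral {0..\<delta>} (\<lambda>s. r *\<^sub>R T s x)"
      by (rule integral_cong) (auto simp: T_linear)
    then show "orbit_int \<delta> (r *\<^sub>R x) = r *\<^sub>R orbit_int \<delta> x"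
      unfolding orbit_int_def by simp
    have "norm (orbit_int \<delta> x) \<le> (M * norm x) * (\<delta> - 0)"
      unfolding orbit_int_def using M assms
      by (intro integral_bound continuous_on_orbit) auto
    then show "norm (orbit_int \<delta> x) \<le> norm x * (M * \<delta>)" by (simp add: mult_ac)
  qed
qed

lemma orbit_int_right_derivative:
  assumes "t \<ge> 0"
  shows "((\<lambda>h. (orbit_int (t + h) x - orbit_int t x) /\<^sub>R h) \<longlongrightarrow> T t x) (at_right 0)"
proof -
  have "((\<lambda>u. orbit_int u x) has_vector_derivative T t x) (at t within {0..t + 1})"
    unfolding orbit_int_def using assms
    by (intro integral_has_vector_derivative continuous_on_orbit) auto
  then have "((\<lambda>u. orbit_int u x) has_vector_derivative T t x) (at t within {t..t + 1})"
    by (rule has_vector_derivative_within_subset) (use assms in auto)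
  then have "((\<lambda>h. (1 / norm h) *\<^sub>R (orbit_int (h + t) x - (orbit_int t x + h *\<^sub>R T t x))) \<longlongrightarrow> 0) (at_right 0)"
    unfolding has_vector_derivative_def has_derivative_within
    by (simp add: at_within_Icc_at_right at_right_to_0[of t] filterlim_filtermap)
  then have "((\<lambda>h. (orbit_int (t + h) x - orbit_int t x) /\<^sub>R h - T t x) \<longlongrightarrow> 0) (at_right 0)"
    by (rule Lim_transform_eventually)
       (auto simp: eventually_at_right_field algebra_simps divide_inverse intro!: exI[of _ 1])
  then show ?thesis by (rule LIM_zero_cancel)
qed

lemma T_orbit_int:
  assumes "h \<ge> 0"
  shows "T h (orbit_int \<delta> x) = orbit_int \<delta> (T h x)"
proof -
  have "T h (orbit_int \<delta> x) = integral {0..\<delta>} (T h \<circ> (\<lambda>s. T s x))"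
    unfolding orbit_int_def by (rule integral_linear[symmetric]) (use assms in \<open>auto intro: lin orbit_integrable\<close>)
  also have "\<dots> = orbit_int \<delta> (T h x)"
    unfolding orbit_int_def by (rule integral_cong) (use assms in \<open>auto simp: add[symmetric] add.commute\<close>)
  finally show ?thesis .
qed

lemma orbit_int_shift:
  assumes "h \<ge> 0" "\<delta> \<ge> 0"
  shows "orbit_int \<delta> (T h x) = orbit_int (\<delta> + h) x - orbit_int h x"
proof -
  have "orbit_int \<delta> (T h x) = integral {0..\<delta>} ((\<lambda>s. T s x) \<circ> (+) h)"
    unfolding orbit_int_def by (rule integral_cong) (use assms in \<open>auto simp: add add.commute[of h]\<close>)
  also have "\<dots> = integral {0 + h..\<delta> + h} (\<lambda>s. T s x)"
    by (rule integral_shift_Icc_real)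
  also have "\<dots> = orbit_int (\<delta> + h) x - orbit_int h x"
    using Henstock_Kurzweil_Integration.integral_combine[of 0 h "\<delta> + h" "\<lambda>s. T s x"] assms
    by (simp add: orbit_int_def orbit_integrable algebra_simps)
  finally show ?thesis .
qed

lemma orbit_int_0 [simp]: "orbit_int 0 x = 0"
  by (simp add: orbit_int_def)

lemma orbit_int_T_0: "orbit_int \<delta> (T 0 x) = orbit_int \<delta> x"
  unfolding orbit_int_def by (rule integral_cong) auto

lemma orbit_int_in_gen:
  assumes "\<delta> > 0"
  shows "(orbit_int \<delta> x, T \<delta> x - T 0 x) \<in> gen"
proof -
  have "((\<lambda>h. (orbit_int (\<delta> + h) x - orbit_int \<delta> x) /\<^sub>R h - (orbit_int (0 + h) x - orbit_int 0 x) /\<^sub>R h)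
      \<longlongrightarrow> T \<delta> x - T 0 x) (at_right 0)"
    using assms by (intro tendsto_diff orbit_int_right_derivative) auto
  then have "((\<lambda>h. (T h (orbit_int \<delta> x) - orbit_int \<delta> x) /\<^sub>R h) \<longlongrightarrow> T \<delta> x - T 0 x) (at_right 0)"
    by (rule Lim_transform_eventually)
       (use assms in \<open>auto simp: eventually_at_right_field T_orbit_int orbit_int_shift orbit_int_0 algebra_simps intro!: exI[of _ 1]\<close>)
  then show ?thesis by (simp add: gen_def T_orbit_int orbit_int_T_0)
qed

lemma orbit_int_gen:
  assumes "\<delta> \<ge> 0" "(x, a) \<in> gen"
  shows "(orbit_int \<delta> x, orbit_int \<delta> a) \<in> gen"
proof -
  interpret bl: bounded_linear "orbit_int \<delta>" using assms by (intro bounded_linear_orbit_int)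
  have "((\<lambda>h. orbit_int \<delta> ((T h x - x) /\<^sub>R h)) \<longlongrightarrow> orbit_int \<delta> a) (at_right 0)"
    using assms by (intro bl.tendsto) (auto simp: gen_def)
  then have "((\<lambda>h. (T h (orbit_int \<delta> x) - orbit_int \<delta> x) /\<^sub>R h) \<longlongrightarrow> orbit_int \<delta> a) (at_right 0)"
    by (rule Lim_transform_eventually)
       (auto simp: eventually_at_right_field T_orbit_int bl.scaleR bl.diff intro!: exI[of _ 1])
  then show ?thesis by (simp add: gen_def T_orbit_int orbit_int_T_0)
qed

lemma orbit_int_approx:
  assumes "T 0 x = x" "\<epsilon> > 0"
  obtains \<delta> where "\<delta> > 0" "norm (x - orbit_int \<delta> x /\<^sub>R \<delta>) < \<epsilon>"
proof -
  have "((\<lambda>h. orbit_int h x /\<^sub>R h) \<longlongrightarrow> x) (at_right 0)"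
    using orbit_int_right_derivative[of 0 x] assms by (simp add: orbit_int_def)
  then have "\<forall>\<^sub>F h in at_right 0. dist (orbit_int h x /\<^sub>R h) x < \<epsilon>" using assms by (intro tendstoD)
  moreover have "\<forall>\<^sub>F h in at_right 0. (h::real) > 0" by (simp add: eventually_at_right_less)
  ultimately have "\<forall>\<^sub>F h in at_right 0. dist (orbit_int h x /\<^sub>R h) x < \<epsilon> \<and> h > 0" by eventually_elim simp
  then obtain h where "h > 0" "dist (orbit_int h x /\<^sub>R h) x < \<epsilon>"
    using eventually_happens'[OF trivial_limit_at_right_real] by blast
  then show ?thesis using that by (auto simp: dist_norm norm_minus_commute)
qed

text \<open>
  The domain of the square of the generator is dense in \<open>{x. T 0 x = x}\<close>: averaging an orbit
  once leads into the domain, and averaging twice into the domain of the square.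
\<close>

lemma gen_square_dense:
  assumes "T 0 x = x" "\<epsilon> > 0"
  shows "\<exists>u a b. (u, a) \<in> gen \<and> (a, b) \<in> gen \<and> norm (x - u) < \<epsilon>"
proof -
  obtain \<delta> where d: "\<delta> > 0" "norm (x - orbit_int \<delta> x /\<^sub>R \<delta>) < \<epsilon> / 2"
    using orbit_int_approx[of x "\<epsilon> / 2"] assms by auto
  define v where "v = orbit_int \<delta> x /\<^sub>R \<delta>"
  define a where "a = (T \<delta> x - T 0 x) /\<^sub>R \<delta>"
  have va: "(v, a) \<in> gen" unfolding v_def a_def by (intro gen_scale orbit_int_in_gen d)
  then have "T 0 v = v" by (simp add: gen_def)
  then obtain \<eta> where e: "\<eta> > 0" "norm (v - orbit_int \<eta> v /\<^sub>R \<eta>) < \<epsilon> / 2"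
    using orbit_int_approx[of v "\<epsilon> / 2"] assms by auto
  have "(orbit_int \<eta> v /\<^sub>R \<eta>, orbit_int \<eta> a /\<^sub>R \<eta>) \<in> gen" "(orbit_int \<eta> a /\<^sub>R \<eta>, (T \<eta> a - T 0 a) /\<^sub>R \<eta>) \<in> gen"
    using e va by (auto intro!: gen_scale orbit_int_gen orbit_int_in_gen)
  moreover have "norm (x - orbit_int \<eta> v /\<^sub>R \<eta>) < \<epsilon>"
    using norm_triangle_ineq[of "x - v" "v - orbit_int \<eta> v /\<^sub>R \<eta>"] d e unfolding v_def[symmetric] by simp
  ultimately show ?thesis by blast
qed

end

text \<open>
  \<open>resolvent h F\<close> is \<open>(I - (F - I) / h)\<inverse>\<close>: the equation \<open>x - (F x - x) / h = y\<close> is multiplied by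
  \<open>h\<close>. For a linear contraction \<open>F\<close> and \<open>h > 0\<close> it has a unique solution, the fixed point of the
  strict contraction \<open>x \<mapsto> (h y + F x) / (1 + h)\<close>.
\<close>

definition resolvent :: "real \<Rightarrow> ('b::banach \<Rightarrow> 'b) \<Rightarrow> 'b \<Rightarrow> 'b" where
  "resolvent h F y = (THE x. (1 + h) *\<^sub>R x = h *\<^sub>R y + F x)"

locale contraction =
  fixes F :: "'b::banach \<Rightarrow> 'b" and h :: real
  assumes lin: "bounded_linear F" and contr: "\<And>x. norm (F x) \<le> norm x" and h: "h > 0"
begin

lemma equation_bound:
  assumes "(1 + h) *\<^sub>R x = h *\<^sub>R y + F x"
  shows "norm x \<le> norm y"
proof -
  have "(1 + h) * norm x = norm ((1 + h) *\<^sub>R x)" using h by simp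
  also have "\<dots> \<le> h * norm y + norm x"
    unfolding assms using norm_triangle_ineq[of "h *\<^sub>R y" "F x"] contr[of x] h by simp
  finally have "h * norm x \<le> h * norm y" by (simp add: algebra_simps)
  then show ?thesis using h by simp
qed

lemma equation_unique:
  assumes "(1 + h) *\<^sub>R x = h *\<^sub>R y + F x" "(1 + h) *\<^sub>R x' = h *\<^sub>R y + F x'"
  shows "x = x'"
proof -
  have "(1 + h) *\<^sub>R (x - x') = h *\<^sub>R 0 + F (x - x')"
    using assms lin by (simp add: linear_simps algebra_simps)
  from equation_bound[OF this] show ?thesis by simp
qed

lemma resolvent_equation: "(1 + h) *\<^sub>R resolvent h F y = h *\<^sub>R y + F (resolvent h F y)"
proof -
  have "\<exists>!x\<in>UNIV. (h *\<^sub>R y + F x) /\<^sub>R (1 + h) = x"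
  proof (rule Banach_fix)
    show "dist ((h *\<^sub>R y + F x) /\<^sub>R (1 + h)) ((h *\<^sub>R y + F x') /\<^sub>R (1 + h))
        \<le> inverse (1 + h) * dist x x'" for x x'
    proof -
      have "(h *\<^sub>R y + F x) /\<^sub>R (1 + h) - (h *\<^sub>R y + F x') /\<^sub>R (1 + h) = F (x - x') /\<^sub>R (1 + h)"
        using lin by (simp add: linear_simps algebra_simps)
      then show "dist ((h *\<^sub>R y + F x) /\<^sub>R (1 + h)) ((h *\<^sub>R y + F x') /\<^sub>R (1 + h))
        \<le> inverse (1 + h) * dist x x'"
        using contr[of "x - x'"] h by (simp add: dist_norm divide_inverse mult_left_mono)
    qed
  qed (use h in \<open>auto simp: complete_UNIV field_simps\<close>)
  then obtain x where "(h *\<^sub>R y + F x) /\<^sub>R (1 + h) = x" by blast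
  then have "(1 + h) *\<^sub>R x = (1 + h) *\<^sub>R ((h *\<^sub>R y + F x) /\<^sub>R (1 + h))" by simp
  then have x: "(1 + h) *\<^sub>R x = h *\<^sub>R y + F x" using h by simp
  show ?thesis
    unfolding resolvent_def by (rule theI[of _ x]) (use x equation_unique in auto)
qed

lemma resolvent_eqI: "(1 + h) *\<^sub>R x = h *\<^sub>R y + F x \<Longrightarrow> resolvent h F y = x"
  using equation_unique resolvent_equation by blast

lemma norm_resolvent_le: "norm (resolvent h F y) \<le> norm y"
  by (rule equation_bound[OF resolvent_equation])

lemma bounded_linear_resolvent: "bounded_linear (resolvent h F)"
proof (rule bounded_linear_intro)
  show "resolvent h F (x + y) = resolvent h F x + resolvent h F y" for x y
    using resolvent_equation[of x] resolvent_equation[of y] lin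
    by (intro resolvent_eqI) (simp add: linear_simps algebra_simps)
  show "resolvent h F (r *\<^sub>R x) = r *\<^sub>R resolvent h F x" for r x
    using arg_cong[OF resolvent_equation[of x], of "scaleR r"] lin
    by (intro resolvent_eqI) (simp add: linear_simps algebra_simps)
  show "norm (resolvent h F x) \<le> norm x * 1" for x
    using norm_resolvent_le by simp
qed

lemma resolvent_inverse: "resolvent h F (x - (F x - x) /\<^sub>R h) = x"
  using h by (intro resolvent_eqI) (simp add: algebra_simps)

lemma F_resolvent: "F (resolvent h F y) = resolvent h F y + h *\<^sub>R (resolvent h F y - y)"
  using resolvent_equation[of y] by (simp add: algebra_simps)

end

text \<open>
  Contractions \<open>F h\<close> whose difference quotients at \<open>0\<close> converge to the generator on a core of it.
\<close>

locale chernoff = degenerate_semigroup T for T :: "real \<Rightarrow> 'b::banach \<Rightarrow> 'b" +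
  fixes F :: "real \<Rightarrow> 'b \<Rightarrow> 'b"
  assumes F_lin: "\<And>h. h > 0 \<Longrightarrow> bounded_linear (F h)"
    and F_contr: "\<And>h x. h > 0 \<Longrightarrow> norm (F h x) \<le> norm x"
    and core: "\<And>x y \<epsilon>. (x, y) \<in> gen \<Longrightarrow> \<epsilon> > 0 \<Longrightarrow>
       \<exists>v w. norm (x - v) + norm (y - w) < \<epsilon> \<and> ((\<lambda>h. (F h v - v) /\<^sub>R h) \<longlongrightarrow> w) (at_right 0)"
begin

abbreviation K :: "real \<Rightarrow> 'b \<Rightarrow> 'b" where
  "K h \<equiv> resolvent h (F h)"

lemma contr: "h > 0 \<Longrightarrow> contraction (F h) h"
  by (rule contraction.intro[OF F_lin F_contr])

lemma resolvent_tendsto: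
  assumes "(x, y) \<in> gen"
  shows "((\<lambda>h. K h (x - y)) \<longlongrightarrow> x) (at_right 0)"
proof (rule tendstoI)
  fix e :: real assume e: "e > 0"
  then obtain v w where vw: "norm (x - v) + norm (y - w) < e / 4"
      "((\<lambda>h. (F h v - v) /\<^sub>R h) \<longlongrightarrow> w) (at_right 0)"
    using core[OF assms, of "e / 4"] by auto
  have "\<forall>\<^sub>F h in at_right 0. dist ((F h v - v) /\<^sub>R h) w < e / 4" using vw(2) e by (intro tendstoD) auto
  moreover have "\<forall>\<^sub>F h in at_right 0. (h::real) > 0" by (simp add: eventually_at_right_less)
  ultimately show "\<forall>\<^sub>F h in at_right 0. dist (K h (x - y)) x < e"
  proof eventually_elim
    case (elim h)
    interpret contraction "F h" h by (rule contr) fact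
    define A where "A = (F h v - v) /\<^sub>R h"
    have 1: "K h (v - A) = v" unfolding A_def by (rule resolvent_inverse)
    have "x - y = (x - v) - (y - w) + (A - w) + (v - A)" by simp
    then have "K h (x - y) - x = K h ((x - v) - (y - w) + (A - w)) + (v - x)"
      using bounded_linear_resolvent 1 by (metis (no_types, lifting) add_diff_eq bounded_linear.linear linear_add)
    then have "norm (K h (x - y) - x) \<le> norm ((x - v) - (y - w) + (A - w)) + norm (v - x)"
      using norm_triangle_ineq norm_resolvent_le by (metis add_mono_thms_linordered_semiring(3) order_trans)
    moreover have "norm ((x - v) - (y - w) + (A - w)) \<le> norm (x - v) + norm (y - w) + norm (A - w)"
      using norm_triangle_ineq norm_triangle_ineq4 by (metis add_mono_thms_linordered_semiring(3) order_trans)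
    moreover have "norm (A - w) < e / 4" using elim(1) by (simp add: dist_norm A_def)
    ultimately show ?case using vw(1) norm_ge_zero[of "y - w"] norm_minus_commute[of v x] e
      unfolding dist_norm by linarith
  qed
qed

text \<open>
  On the compact orbits, the convergence of the equicontinuous operators \<open>K h\<close> is uniform.
\<close>

lemma resolvent_uniform:
  assumes xy: "(x, y) \<in> gen" and e: "e > 0"
  shows "\<forall>\<^sub>F h in at_right 0. \<forall>s\<in>{0..\<tau>}. norm (K h (T s (x - y)) - T s x) < e"
proof -
  have cont: "uniformly_continuous_on {0..\<tau>} (\<lambda>s. T s z)" for z
    by (intro compact_uniformly_continuous continuous_on_orbit) auto
  obtain d1 where d1: "d1 > 0" "\<And>s s'. s \<in> {0..\<tau>} \<Longrightarrow> s' \<in> {0..\<tau>} \<Longrightarrow> dist s' s < d1 \<Longrightarrow>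
      dist (T s' (x - y)) (T s (x - y)) < e / 3"
    using cont[of "x - y"] e unfolding uniformly_continuous_on_def by (metis zero_less_divide_iff zero_less_numeral)
  obtain d2 where d2: "d2 > 0" "\<And>s s'. s \<in> {0..\<tau>} \<Longrightarrow> s' \<in> {0..\<tau>} \<Longrightarrow> dist s' s < d2 \<Longrightarrow>
      dist (T s' x) (T s x) < e / 3"
    using cont[of x] e unfolding uniformly_continuous_on_def by (metis zero_less_divide_iff zero_less_numeral)
  define d where "d = min d1 d2"
  have d: "d > 0" using d1 d2 by (simp add: d_def)
  obtain N where N: "finite N" "N \<subseteq> {0..\<tau>}" "{0..\<tau>} \<subseteq> (\<Union>c\<in>N. ball c d)"
  proof (rule compactE_image[of "{0..\<tau>}" "{0..\<tau>}" "\<lambda>c. ball c d"])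
    show "{0..\<tau>} \<subseteq> (\<Union>c\<in>{0..\<tau>}. ball c d)" using d by force
  qed auto
  have "\<forall>c\<in>N. \<forall>\<^sub>F h in at_right 0. dist (K h (T c (x - y))) (T c x) < e / 3"
  proof
    fix c assume "c \<in> N"
    then have c: "c \<ge> 0" using N by auto
    have "((\<lambda>h. K h (T c x - T c y)) \<longlongrightarrow> T c x) (at_right 0)"
      by (intro resolvent_tendsto gen_semigroup xy c)
    then show "\<forall>\<^sub>F h in at_right 0. dist (K h (T c (x - y))) (T c x) < e / 3"
      unfolding T_linear(2)[OF c] by (rule tendstoD) (use e in auto)
  qed
  then have "\<forall>\<^sub>F h in at_right 0. \<forall>c\<in>N. dist (K h (T c (x - y))) (T c x) < e / 3"
    using N by (simp add: eventually_ball_finite)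
  moreover have "\<forall>\<^sub>F h in at_right 0. (h::real) > 0" by (simp add: eventually_at_right_less)
  ultimately show ?thesis
  proof eventually_elim
    case (elim h)
    interpret contraction "F h" h by (rule contr) fact
    show ?case
    proof
      fix s assume s: "s \<in> {0..\<tau>}"
      then obtain c where c: "c \<in> N" "dist s c < d" using N(3) by (force simp: dist_commute)
      then have c': "c \<in> {0..\<tau>}" using N by auto
      have "norm (K h (T s (x - y)) - K h (T c (x - y))) \<le> norm (T s (x - y) - T c (x - y))"
        using norm_resolvent_le[of "T s (x - y) - T c (x - y)"] bounded_linear_resolvent
        by (simp add: linear_simps)
      moreover have "norm (T s (x - y) - T c (x - y)) < e / 3"
        using d1(2)[OF c' s] c by (simp add: d_def dist_norm)
      moreover have "norm (T c x - T s x) < e / 3"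
        using d2(2)[OF c' s] c by (simp add: d_def dist_norm norm_minus_commute)
      moreover have "norm (K h (T c (x - y)) - T c x) < e / 3" using elim c by (auto simp: dist_norm)
      moreover have eq: "K h (T s (x - y)) - T s x = (K h (T s (x - y)) - K h (T c (x - y))) +
          (K h (T c (x - y)) - T c x) + (T c x - T s x)" by simp
      ultimately show "norm (K h (T s (x - y)) - T s x) < e"
        unfolding eq
        using norm_triangle_ineq[of "(K h (T s (x - y)) - K h (T c (x - y))) +
          (K h (T c (x - y)) - T c x)" "T c x - T s x"]
          norm_triangle_ineq[of "K h (T s (x - y)) - K h (T c (x - y))" "K h (T c (x - y)) - T c x"]
        by linarith
    qed
  qed
qed

text \<open>
  The product formula on the domain of the square of the generator, by comparison of the powers
  of \<open>F h\<close> with the curve \<open>X s = K h (T s (u - a))\<close>.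
\<close>

lemma chernoff_smooth:
  assumes ua: "(u, a) \<in> gen" and ab: "(a, b) \<in> gen" and e: "e > 0" and \<tau>: "\<tau> \<ge> 0"
  shows "\<forall>\<^sub>F h in at_right 0. \<forall>n. real n * h \<le> \<tau> \<longrightarrow> norm ((F h ^^ n) u - T (real n * h) u) < e"
proof -
  obtain M where M: "M \<ge> 1" "\<And>s x. s \<in> {0..\<tau>} \<Longrightarrow> norm (T s x) \<le> M * norm x"
    using bounded_on_interval by blast
  define y z where "y = u - a" and "z = a - b"
  have yz: "(y, z) \<in> gen" unfolding y_def z_def by (intro gen_diff ua ab)
  \<comment> \<open>Each of at most \<open>\<tau> / h\<close> steps contributes an error \<open>2 \<eta> h\<close>, in total at most \<open>e / 4\<close>.\<close>
  define \<eta> where "\<eta> = e / (8 * (\<tau> + 1))"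
  have \<eta>: "\<eta> > 0" using e \<tau> by (simp add: \<eta>_def)
  have "\<forall>\<^sub>F h in at_right 0. \<forall>s\<in>{0..\<tau>}. norm (K h (T s (y - z)) - T s y) < \<eta>"
    by (rule resolvent_uniform[OF yz \<eta>])
  moreover have "\<forall>\<^sub>F h in at_right 0. \<forall>s\<in>{0..\<tau>}. norm (K h (T s (u - a)) - T s u) < e / 4"
    by (rule resolvent_uniform[OF ua]) (use e in auto)
  moreover have "\<forall>\<^sub>F h in at_right 0. dist ((T h y - y) /\<^sub>R h) z < \<eta> / M"
    using yz \<eta> M by (intro tendstoD) (auto simp: gen_def)
  moreover have "\<forall>\<^sub>F h in at_right 0. (h::real) > 0" by (simp add: eventually_at_right_less)
  ultimately show ?thesis
  proof eventually_elim
    case (elim h)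
    interpret contraction "F h" h by (rule contr) fact
    have Kdiff: "K h (p - q) = K h p - K h q" and Kadd: "K h (p + q) = K h p + K h q"
      and Kscale: "K h (c *\<^sub>R p) = c *\<^sub>R K h p" for p q c
      using bounded_linear_resolvent by (simp_all add: linear_simps)
    define X where "X s = K h (T s y)" for s
    have step: "norm (X (s + h) - F h (X s)) \<le> 2 * \<eta> * h" if s: "s \<in> {0..\<tau>}" for s
    proof -
      define q where "q = (T h y - y) /\<^sub>R h - z"
      have "T h y = y + h *\<^sub>R (z + q)"
        using elim(4) by (simp add: q_def)
      then have eq: "T (s + h) y = T s y + h *\<^sub>R (T s z + T s q)"
        using s elim(4) by (simp add: add T_linear)
      \<comment> \<open>Since \<open>X s - (F h (X s) - X s) / h = T s y\<close>, the defect is governed by the convergence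
        of \<open>K h\<close> at \<open>T s (y - z)\<close>.\<close>
      have "X (s + h) - F h (X s) = h *\<^sub>R (K h (T s q) - (K h (T s (y - z)) - T s y))"
        unfolding X_def F_resolvent eq Kadd Kscale
        using s by (simp add: T_linear Kdiff algebra_simps)
      moreover have "norm (K h (T s q) - (K h (T s (y - z)) - T s y)) \<le> \<eta> + \<eta>"
      proof -
        have "norm (K h (T s q)) \<le> norm (T s q)" by (rule norm_resolvent_le)
        also have "\<dots> \<le> M * norm q" using M s by auto
        also have "\<dots> \<le> M * (\<eta> / M)" using elim(3) M by (intro mult_left_mono) (auto simp: q_def dist_norm)
        finally have "norm (K h (T s q)) \<le> \<eta>" using M by simp
        moreover have "norm (K h (T s (y - z)) - T s y) \<le> \<eta>" using elim(1) s by fastforce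
        ultimately show ?thesis using norm_triangle_ineq4 by (metis add_mono order_trans)
      qed
      ultimately show ?thesis using elim(4) by (simp add: mult.commute mult_left_mono)
    qed
    have Flin: "F h (p - q) = F h p - F h q" for p q using lin by (simp add: linear_simps)
    have tele: "norm ((F h ^^ n) (X 0) - X (real n * h)) \<le> real n * (2 * \<eta> * h)"
      if "real n * h \<le> \<tau>" for n
      using that
    proof (induction n)
      case 0
      then show ?case by simp
    next
      case (Suc n)
      have le: "real n * h \<le> \<tau>" using Suc.prems elim(4) by (simp add: algebra_simps)
      have "(F h ^^ Suc n) (X 0) - X (real (Suc n) * h)
          = F h ((F h ^^ n) (X 0) - X (real n * h)) - (X (real n * h + h) - F h (X (real n * h)))"
        by (simp add: Flin algebra_simps)
      also have "norm \<dots> \<le> norm (F h ((F h ^^ n) (X 0) - X (real n * h)))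
          + norm (X (real n * h + h) - F h (X (real n * h)))" by (rule norm_triangle_ineq4)
      also have "\<dots> \<le> real n * (2 * \<eta> * h) + 2 * \<eta> * h"
        using Suc.IH[OF le] contr step[of "real n * h"] le elim(4)
        by (intro add_mono) (auto intro: order_trans)
      finally show ?case by (simp add: algebra_simps)
    qed
    have Fpow_diff: "(F h ^^ n) (p - q) = (F h ^^ n) p - (F h ^^ n) q" for n p q
      by (induction n) (auto simp: Flin)
    have Fpow_contr: "norm ((F h ^^ n) p) \<le> norm p" for n p
      by (induction n) (auto intro: order_trans contr)
    have T0u: "T 0 u = u" using ua by (simp add: gen_def)
    show ?case
    proof (intro allI impI)
      fix n assume n: "real n * h \<le> \<tau>"
      have nh: "real n * h \<in> {0..\<tau>}" using n elim(4) by simp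
      have "norm ((F h ^^ n) (u - X 0)) \<le> norm (u - X 0)" by (rule Fpow_contr)
      moreover have "norm (u - X 0) < e / 4"
        using elim(2) \<tau> T0u by (auto simp: X_def y_def norm_minus_commute dest!: bspec[of _ _ 0])
      moreover have "norm (X (real n * h) - T (real n * h) u) < e / 4"
        using elim(2) nh by (auto simp: X_def y_def)
      moreover have "norm ((F h ^^ n) (X 0) - X (real n * h)) \<le> e / 4"
      proof -
        have "norm ((F h ^^ n) (X 0) - X (real n * h)) \<le> (real n * h) * (2 * \<eta>)"
          using tele[OF n] by (simp add: mult_ac)
        also have "\<dots> \<le> (\<tau> + 1) * (2 * \<eta>)" using n \<eta> by (intro mult_right_mono) auto
        also have "\<dots> = e / 4" using \<tau> by (simp add: \<eta>_def divide_simps)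
        finally show ?thesis .
      qed
      moreover have eq: "(F h ^^ n) u - T (real n * h) u = (F h ^^ n) (u - X 0)
          + ((F h ^^ n) (X 0) - X (real n * h)) + (X (real n * h) - T (real n * h) u)"
        by (simp add: Fpow_diff)
      ultimately show "norm ((F h ^^ n) u - T (real n * h) u) < e"
        unfolding eq using norm_triangle_ineq[of "(F h ^^ n) (u - X 0) + ((F h ^^ n) (X 0) - X (real n * h))"
            "X (real n * h) - T (real n * h) u"]
          norm_triangle_ineq[of "(F h ^^ n) (u - X 0)" "(F h ^^ n) (X 0) - X (real n * h)"] e
        by linarith
    qed
  qed
qed

lemma chernoff_formula:
  assumes x: "T 0 x = x" and e: "e > 0" and \<tau>: "\<tau> \<ge> 0"
  shows "\<forall>\<^sub>F h in at_right 0. \<forall>n. real n * h \<le> \<tau> \<longrightarrow> norm ((F h ^^ n) x - T (real n * h) x) < e"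
proof -
  obtain M where M: "M \<ge> 1" "\<And>s x. s \<in> {0..\<tau>} \<Longrightarrow> norm (T s x) \<le> M * norm x"
    using bounded_on_interval by blast
  obtain u a b where u: "(u, a) \<in> gen" "(a, b) \<in> gen" "norm (x - u) < e / (3 * M)"
    using gen_square_dense[OF x, of "e / (3 * M)"] e M by auto
  have "\<forall>\<^sub>F h in at_right 0. \<forall>n. real n * h \<le> \<tau> \<longrightarrow> norm ((F h ^^ n) u - T (real n * h) u) < e / 3"
    by (rule chernoff_smooth[OF u(1,2)]) (use e \<tau> in auto)
  moreover have "\<forall>\<^sub>F h in at_right 0. (h::real) > 0" by (simp add: eventually_at_right_less)
  ultimately show ?thesis
  proof eventually_elim
    case (elim h)
    have Fpow_diff: "(F h ^^ n) (p - q) = (F h ^^ n) p - (F h ^^ n) q" for n p q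
      by (induction n) (use F_lin elim in \<open>auto simp: linear_simps\<close>)
    have Fpow_contr: "norm ((F h ^^ n) p) \<le> norm p" for n p
      by (induction n) (use F_contr elim in \<open>auto intro: order_trans\<close>)
    show ?case
    proof (intro allI impI)
      fix n assume n: "real n * h \<le> \<tau>"
      have nh: "real n * h \<in> {0..\<tau>}" using n elim(2) by simp
      have M1: "M * norm (x - u) < e / 3" using u(3) M by (simp add: field_simps)
      moreover have "norm (x - u) \<le> M * norm (x - u)" using M mult_right_mono[of 1 M "norm (x - u)"] by simp
      ultimately have "norm (x - u) < e / 3" by linarith
      then have "norm ((F h ^^ n) (x - u)) < e / 3" using Fpow_contr[of n "x - u"] by linarith
      moreover have "norm (T (real n * h) (x - u)) < e / 3" using M(2)[OF nh] M1 by (meson le_less_trans)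
      moreover have "norm ((F h ^^ n) u - T (real n * h) u) < e / 3" using elim n by blast
      moreover have eq: "(F h ^^ n) x - T (real n * h) x = (F h ^^ n) (x - u)
          + ((F h ^^ n) u - T (real n * h) u) - T (real n * h) (x - u)"
        using nh by (simp add: Fpow_diff T_linear)
      ultimately show "norm ((F h ^^ n) x - T (real n * h) x) < e"
        unfolding eq using norm_triangle_ineq4[of "(F h ^^ n) (x - u) + ((F h ^^ n) u - T (real n * h) u)" "T (real n * h) (x - u)"]
          norm_triangle_ineq[of "(F h ^^ n) (x - u)" "(F h ^^ n) u - T (real n * h) u"]
        by linarith
    qed
  qed
qed

end

section \<open>Smooth radial functions\<close>

lemma partial_deriv_eq:
  assumes "(f has_derivative f') (at x)"
  shows "partial_deriv b f x = f' b"
  using frechet_derivative_at[OF assms] by (simp add: partial_deriv_def)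

lemma Ck_on_SucI:
  assumes "\<And>x. (f has_derivative f' x) (at x)" "\<And>b. b \<in> Basis \<Longrightarrow> Ck_on k UNIV (\<lambda>x. f' x b)"
  shows "Ck_on (Suc k) UNIV f"
proof -
  have "partial_deriv b f = (\<lambda>x. f' x b)" for b
    using assms(1) by (auto intro: partial_deriv_eq)
  then show ?thesis using assms by (auto simp: differentiable_def)
qed

lemma Ck_on_SucD: "Ck_on (Suc k) UNIV f \<Longrightarrow> Ck_on k UNIV f"
  by (induction k arbitrary: f)
     (auto intro!: continuous_at_imp_continuous_on differentiable_imp_continuous_within)

lemma Ck_on_derivative:
  assumes "Ck_on (Suc k) UNIV f"
  shows "(f has_derivative (\<lambda>h. frechet_derivative f (at x) h)) (at x)"
    "b \<in> Basis \<Longrightarrow> Ck_on k UNIV (\<lambda>x. frechet_derivative f (at x) b)"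
  using assms by (auto simp: frechet_derivative_works partial_deriv_def[abs_def])

lemma Ck_on_const: "Ck_on k UNIV (\<lambda>x. c)"
proof (induction k arbitrary: c)
  case (Suc k)
  show ?case by (rule Ck_on_SucI) (auto intro: derivative_eq_intros Suc)
qed auto

lemma Ck_on_add: "Ck_on k UNIV f \<Longrightarrow> Ck_on k UNIV g \<Longrightarrow> Ck_on k UNIV (\<lambda>x. f x + g x)"
proof (induction k arbitrary: f g)
  case 0
  then show ?case by (auto intro: continuous_intros)
next
  case (Suc k)
  show ?case
    by (rule Ck_on_SucI[OF has_derivative_add[OF Ck_on_derivative(1)[OF Suc.prems(1)] Ck_on_derivative(1)[OF Suc.prems(2)]]])
       (intro Suc.IH Ck_on_derivative(2) Suc.prems)
qed

lemma Ck_on_mult: "Ck_on k UNIV f \<Longrightarrow> Ck_on k UNIV g \<Longrightarrow> Ck_on k UNIV (\<lambda>x. f x * g x)"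
proof (induction k arbitrary: f g)
  case 0
  then show ?case by (auto intro: continuous_intros)
next
  case (Suc k)
  show ?case
    by (rule Ck_on_SucI[OF has_derivative_mult[OF Ck_on_derivative(1)[OF Suc.prems(1)] Ck_on_derivative(1)[OF Suc.prems(2)]]])
       (intro Suc.IH Ck_on_add Ck_on_derivative(2) Suc.prems Ck_on_SucD[OF Suc.prems(1)] Ck_on_SucD[OF Suc.prems(2)])
qed

lemma Ck_on_inner: "Ck_on k UNIV (\<lambda>x::'a::euclidean_space. (x - p) \<bullet> b)"
proof (cases k)
  case (Suc m)
  show ?thesis unfolding Suc
    by (rule Ck_on_SucI[where f' = "\<lambda>x h. h \<bullet> b"]) (auto intro!: derivative_eq_intros Ck_on_const)
qed (auto intro!: continuous_intros)

lemma radial_has_derivative: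
  fixes p y :: "'a::euclidean_space"
  assumes "\<And>r. (q has_real_derivative q' r) (at r)"
  shows "((\<lambda>y. q ((norm (y - p))\<^sup>2)) has_derivative
      (\<lambda>h. q' ((norm (y - p))\<^sup>2) * (2 * ((y - p) \<bullet> h)))) (at y)"
proof -
  have "((\<lambda>y. (norm (y - p))\<^sup>2) has_derivative (\<lambda>h. 2 * ((y - p) \<bullet> h))) (at y)"
    unfolding power2_norm_eq_inner by (auto intro!: derivative_eq_intros simp: inner_commute)
  from has_derivative_compose[OF this, of q] show ?thesis
    using assms[of "(norm (y - p))\<^sup>2"] unfolding has_field_derivative_def by blast
qed

text \<open>Here \<open>Q (Suc j)\<close> is the derivative of \<open>Q j\<close>, so that every \<open>Q j\<close> is smooth.\<close>

lemma Ck_on_radial: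
  fixes p :: "'a::euclidean_space"
  assumes "\<And>j r. (Q j has_real_derivative Q (Suc j) r) (at r)"
  shows "Ck_on k UNIV (\<lambda>y. Q j ((norm (y - p))\<^sup>2))"
proof (induction k arbitrary: j)
  case 0
  have "continuous_on UNIV (Q j)" by (rule DERIV_continuous_on) (rule assms)
  then have "continuous_on UNIV (\<lambda>y. Q j ((norm (y - p))\<^sup>2))"
    by (rule continuous_on_compose2) (auto intro!: continuous_intros)
  then show ?case by simp
next
  case (Suc k)
  show ?case
    by (rule Ck_on_SucI[OF radial_has_derivative[OF assms]])
       (intro Ck_on_mult Suc.IH Ck_on_const Ck_on_inner[where p = p])
qed

lemma laplacian_radial:
  fixes p y :: "'a::euclidean_space"
  assumes "\<And>r. (q has_real_derivative q' r) (at r)" "\<And>r. (q' has_real_derivative q'' r) (at r)"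
  shows "laplacian (\<lambda>y. q ((norm (y - p))\<^sup>2)) y
     = 4 * (norm (y - p))\<^sup>2 * q'' ((norm (y - p))\<^sup>2) + 2 * real DIM('a) * q' ((norm (y - p))\<^sup>2)"
proof -
  have 1: "partial_deriv b (\<lambda>y. q ((norm (y - p))\<^sup>2)) = (\<lambda>y. q' ((norm (y - p))\<^sup>2) * (2 * ((y - p) \<bullet> b)))" for b
    by (rule ext partial_deriv_eq radial_has_derivative assms)+
  have 2: "partial_deriv b (\<lambda>y. q' ((norm (y - p))\<^sup>2) * (2 * ((y - p) \<bullet> b))) y
     = 4 * q'' ((norm (y - p))\<^sup>2) * ((y - p) \<bullet> b)\<^sup>2 + 2 * q' ((norm (y - p))\<^sup>2)" if "b \<in> Basis" for b
  proof -
    have "((\<lambda>y. 2 * ((y - p) \<bullet> b)) has_derivative (\<lambda>h. 2 * (h \<bullet> b))) (at y)"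
      by (auto intro!: derivative_eq_intros)
    from partial_deriv_eq[OF has_derivative_mult[OF radial_has_derivative[OF assms(2)] this]]
    show ?thesis using that by (simp add: power2_eq_square)
  qed
  have "(\<Sum>b\<in>Basis. ((y - p) \<bullet> b)\<^sup>2) = (norm (y - p))\<^sup>2"
    unfolding power2_norm_eq_inner euclidean_inner[of "y - p" "y - p"] by (simp add: power2_eq_square)
  then show ?thesis
    unfolding laplacian_def 1 by (simp add: 2 sum.distrib sum_distrib_left[symmetric])
qed

section \<open>Smooth cut-offs of Gaussians\<close>

text \<open>
  The functions \<open>p (1 / s) exp (1 - 1 / s)\<close> on \<open>s > 0\<close>, with \<open>p\<close> a polynomial, extended by \<open>0\<close>;
  this class is closed under differentiation, and \<open>bump_step\<close> is the effect on the polynomial.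
\<close>

definition bump_fun :: "real poly \<Rightarrow> real \<Rightarrow> real" where
  "bump_fun p s = (if s > 0 then poly p (1 / s) * exp (1 - 1 / s) else 0)"

definition bump_step :: "real poly \<Rightarrow> real poly" where
  "bump_step p = [:0, 0, 1:] * (p - pderiv p)"

lemma poly_exp_tendsto_0: "((\<lambda>x. poly p x * exp (1 - x)) \<longlongrightarrow> 0) at_top" for p :: "real poly"
proof -
  have "((\<lambda>x. \<Sum>i\<le>degree p. coeff p i * exp 1 * (x ^ i / exp x)) \<longlongrightarrow> (\<Sum>i\<le>degree p. coeff p i * exp 1 * 0)) at_top"
    by (intro tendsto_intros tendsto_power_div_exp_0)
  also have "(\<lambda>x. \<Sum>i\<le>degree p. coeff p i * exp 1 * (x ^ i / exp x)) = (\<lambda>x. poly p x * exp (1 - x))"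
    by (auto simp: poly_altdef exp_diff sum_distrib_left sum_distrib_right sum_divide_distrib mult_ac)
  finally show ?thesis by simp
qed

lemma bump_fun_DERIV: "(bump_fun p has_real_derivative bump_fun (bump_step p) s) (at s)"
proof (cases s "0::real" rule: linorder_cases)
  case greater
  have "((\<lambda>s. poly p (1 / s) * exp (1 - 1 / s)) has_real_derivative bump_fun (bump_step p) s) (at s)"
  proof -
    have 1: "((\<lambda>s. 1 / s) has_real_derivative - ((1 / s)\<^sup>2)) (at s)"
      using greater by (auto intro!: derivative_eq_intros simp: power2_eq_square)
    have 2: "((\<lambda>s. exp (1 - 1 / s)) has_real_derivative exp (1 - 1 / s) * (0 - - ((1 / s)\<^sup>2))) (at s)"
      by (intro DERIV_chain2[OF DERIV_exp] DERIV_diff DERIV_const 1)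
    have "bump_fun (bump_step p) s = (1 / s)\<^sup>2 * (poly p (1 / s) - poly (pderiv p) (1 / s)) * exp (1 - 1 / s)"
      using greater by (simp add: bump_fun_def bump_step_def power2_eq_square)
    then show ?thesis
      by (intro DERIV_cong[OF DERIV_mult[OF DERIV_chain2[OF poly_DERIV 1] 2]]) (simp add: algebra_simps)
  qed
  then show ?thesis
    by (rule has_field_derivative_transform_within_open[of _ _ _ "{0<..}"])
       (use greater in \<open>auto simp: bump_fun_def\<close>)
next
  case less
  have "((\<lambda>s. 0) has_real_derivative bump_fun (bump_step p) s) (at s)"
    using less by (auto simp: bump_fun_def)
  then show ?thesis
    by (rule has_field_derivative_transform_within_open[of _ _ _ "{..<0}"])
       (use less in \<open>auto simp: bump_fun_def\<close>)
next
  case equal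
  have "((\<lambda>h. bump_fun p h / h) \<longlongrightarrow> 0) (at 0)"
  proof (rule filterlim_split_at)
    show "((\<lambda>h. bump_fun p h / h) \<longlongrightarrow> 0) (at_left 0)"
      by (rule tendsto_eventually) (auto simp: eventually_at_left_field bump_fun_def intro!: exI[of _ "-1"])
    have "((\<lambda>h. poly (pCons 0 p) (inverse h) * exp (1 - inverse h)) \<longlongrightarrow> 0) (at_right 0)"
      by (rule filterlim_compose[OF poly_exp_tendsto_0 filterlim_inverse_at_top_right])
    then show "((\<lambda>h. bump_fun p h / h) \<longlongrightarrow> 0) (at_right 0)"
      by (rule Lim_transform_eventually)
         (auto simp: eventually_at_right_field bump_fun_def field_simps intro!: exI[of _ 1])
  qed
  then show ?thesis using equal by (simp add: DERIV_def bump_fun_def)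
qed

text \<open>The \<open>j\<close>-th derivative of the smooth function \<open>exp (1 - 1 / s)\<close>, which vanishes for \<open>s \<le> 0\<close>.\<close>

definition bump :: "nat \<Rightarrow> real \<Rightarrow> real" where
  "bump j = bump_fun ((bump_step ^^ j) 1)"

lemma bump_DERIV: "(bump j has_real_derivative bump (Suc j) s) (at s)"
  unfolding bump_def by (simp add: bump_fun_DERIV)

lemma bump_rescaled_DERIV:
  "((\<lambda>r. bump j (1 - r / R)) has_real_derivative - bump (Suc j) (1 - r / R) / R) (at r)"
proof -
  have "((\<lambda>r. 1 - r / R) has_real_derivative 0 - 1 / R) (at r)"
    by (intro DERIV_diff DERIV_const DERIV_cdivide DERIV_ident)
  from DERIV_chain2[OF bump_DERIV this] show ?thesis by simp
qed

lemma bump_eq_0: "s \<le> 0 \<Longrightarrow> bump j s = 0"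
  by (simp add: bump_def bump_fun_def)

lemma bump_pos: "s > 0 \<Longrightarrow> bump 0 s > 0"
  by (simp add: bump_def bump_fun_def)

lemma bump_1: "bump 0 1 = 1"
  by (simp add: bump_def bump_fun_def)

lemma bump_isCont: "isCont (bump j) s"
  using bump_DERIV DERIV_isCont by blast

lemma bump_bounded: "\<exists>C\<ge>0. \<forall>s\<le>1. \<bar>bump j s\<bar> \<le> C"
proof -
  have "compact (bump j ` {0..1})"
    by (intro compact_continuous_image continuous_at_imp_continuous_on) (auto simp: bump_isCont)
  then have "bounded (bump j ` {0..1})" by (rule compact_imp_bounded)
  then obtain C where C: "\<forall>s\<in>{0..1}. \<bar>bump j s\<bar> \<le> C" by (auto simp: bounded_iff)
  then have "C \<ge> 0" by (metis abs_ge_zero atLeastAtMost_iff order.trans order_refl zero_le_one)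
  moreover have "\<bar>bump j s\<bar> \<le> C" if "s \<le> 1" for s
    using that C \<open>C \<ge> 0\<close> by (cases "s \<ge> 0") (auto simp: bump_eq_0)
  ultimately show ?thesis by blast
qed

text \<open>
  As a function of \<open>r = |y - p|\<^sup>2\<close>, a Gaussian multiplied, for \<open>R > 0\<close>, by a smooth factor that
  vanishes for \<open>r \<ge> R\<close> and tends to \<open>1\<close> as \<open>R \<rightarrow> \<infinity>\<close>. For \<open>a = 0\<close> it is a plain bump function.
\<close>

definition cutoff_gauss :: "real \<Rightarrow> real \<Rightarrow> real \<Rightarrow> real" where
  "cutoff_gauss a R r = bump 0 (1 - r / R) * exp (- a * r)"

lemma cutoff_gauss_DERIV:
  "(cutoff_gauss a R has_real_derivative
     (- bump 1 (1 - r / R) / R - a * bump 0 (1 - r / R)) * exp (- a * r)) (at r)"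
  unfolding cutoff_gauss_def[abs_def]
  by (auto intro!: derivative_eq_intros bump_rescaled_DERIV simp: algebra_simps)

lemma cutoff_gauss_DERIV2:
  "((\<lambda>r. (- bump 1 (1 - r / R) / R - a * bump 0 (1 - r / R)) * exp (- a * r)) has_real_derivative
     (bump 2 (1 - r / R) / R\<^sup>2 + 2 * a * bump 1 (1 - r / R) / R + a\<^sup>2 * bump 0 (1 - r / R)) * exp (- a * r)) (at r)"
proof -
  have 1: "((\<lambda>r. exp (- a * r)) has_real_derivative - a * exp (- a * r)) (at r)"
    by (auto intro!: derivative_eq_intros)
  have "((\<lambda>r. - bump 1 (1 - r / R) / R - a * bump 0 (1 - r / R)) has_real_derivative
      - (- bump 2 (1 - r / R) / R) / R - a * (- bump 1 (1 - r / R) / R)) (at r)"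
    using bump_rescaled_DERIV[of 1 R r] bump_rescaled_DERIV[of 0 R r]
    by (intro DERIV_diff DERIV_cdivide DERIV_minus DERIV_cmult) (auto simp: numeral_2_eq_2)
  from DERIV_mult[OF this 1] show ?thesis
    by (rule DERIV_cong) (simp add: algebra_simps power2_eq_square)
qed

lemma cutoff_gauss_test_fun:
  fixes p :: "'a::euclidean_space"
  assumes "R > 0" "cball p (sqrt R) \<subseteq> S"
  shows "(\<lambda>y. cutoff_gauss a R ((norm (y - p))\<^sup>2)) \<in> test_fun S"
proof -
  define \<phi> where "\<phi> = (\<lambda>y. cutoff_gauss a R ((norm (y - p))\<^sup>2))"
  have "Ck_on k UNIV \<phi>" for k
  proof -
    have 1: "((\<lambda>r. (- 1 / R) ^ j * bump j (1 - r / R)) has_real_derivative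
        (- 1 / R) ^ Suc j * bump (Suc j) (1 - r / R)) (at r)" for j r
      by (auto intro!: derivative_eq_intros bump_rescaled_DERIV)
    have 2: "((\<lambda>r. (- a) ^ j * exp (- a * r)) has_real_derivative (- a) ^ Suc j * exp (- a * r)) (at r)" for j r
      by (auto intro!: derivative_eq_intros)
    show ?thesis
      using Ck_on_mult[OF Ck_on_radial[where Q = "\<lambda>j r. (- 1 / R) ^ j * bump j (1 - r / R)", OF 1, of k 0 p]
          Ck_on_radial[where Q = "\<lambda>j r. (- a) ^ j * exp (- a * r)", OF 2, of k 0 p]]
      by (simp add: \<phi>_def cutoff_gauss_def)
  qed
  moreover have sub: "closure {x. \<phi> x \<noteq> 0} \<subseteq> cball p (sqrt R)"
  proof (rule closure_minimal)
    show "{x. \<phi> x \<noteq> 0} \<subseteq> cball p (sqrt R)"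
    proof clarify
      fix x assume "\<phi> x \<noteq> 0"
      then have "1 - (norm (x - p))\<^sup>2 / R > 0" by (auto simp: \<phi>_def cutoff_gauss_def bump_eq_0 not_le[symmetric])
      then have "(norm (x - p))\<^sup>2 \<le> R" using assms by (simp add: field_simps)
      then have "norm (x - p) \<le> sqrt R" by (rule real_le_rsqrt)
      then show "x \<in> cball p (sqrt R)" by (simp add: dist_norm norm_minus_commute)
    qed
  qed auto
  moreover have "compact (closure {x. \<phi> x \<noteq> 0})"
    using sub by (meson bounded_cball bounded_subset closed_closure compact_eq_bounded_closed)
  ultimately show ?thesis
    using assms(2) unfolding \<phi>_def[symmetric] by (auto simp: test_fun_def smooth_on_def)
qed

section \<open>Gaussian integrals\<close>

lemma gauss_real:
  assumes "a > 0"
  shows "has_bochner_integral lborel (\<lambda>x::real. exp (- a * x\<^sup>2)) (sqrt (pi / a))"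
proof -
  define \<sigma> where "\<sigma> = sqrt (1 / (2 * a))"
  have \<sigma>: "\<sigma> > 0" "\<sigma>\<^sup>2 = 1 / (2 * a)" using assms by (auto simp: \<sigma>_def)
  have "has_bochner_integral lborel (\<lambda>x. sqrt (pi / a) * normal_density 0 \<sigma> x) (sqrt (pi / a) * 1)"
    using \<sigma> by (intro has_bochner_integral_mult_right) (auto simp: has_bochner_integral_iff)
  also have "(\<lambda>x. sqrt (pi / a) * normal_density 0 \<sigma> x) = (\<lambda>x. exp (- a * x\<^sup>2))"
    using assms by (auto simp: normal_density_def \<sigma>(2))
  finally show ?thesis by simp
qed

lemma gauss_euclidean:
  assumes "a > 0"
  shows "integrable lborel (\<lambda>z::'a::euclidean_space. exp (- a * (norm z)\<^sup>2))"
    and "(\<integral>z. exp (- a * (norm (z::'a))\<^sup>2) \<partial>lborel) = (pi / a) powr (real DIM('a) / 2)"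
proof -
  interpret product_sigma_finite "\<lambda>_::'a. lborel :: real measure" ..
  let ?P = "Pi\<^sub>M (Basis::'a set) (\<lambda>_. lborel :: real measure)"
  have ints: "integrable lborel (\<lambda>x::real. exp (- a * x\<^sup>2))" "(\<integral>x. exp (- a * x\<^sup>2) \<partial>lborel) = sqrt (pi / a)"
    using gauss_real[OF assms] by (auto simp: has_bochner_integral_iff)
  have norm_sum: "exp (- a * (norm (\<Sum>b\<in>(Basis::'a set). f b *\<^sub>R b))\<^sup>2) = (\<Prod>b\<in>Basis. exp (- a * (f b)\<^sup>2))" for f
  proof -
    have "(norm (\<Sum>b\<in>(Basis::'a set). f b *\<^sub>R b))\<^sup>2 = (\<Sum>b\<in>Basis. (f b)\<^sup>2)"
      unfolding power2_norm_eq_inner by (subst euclidean_inner) (simp add: power2_eq_square)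
    then show ?thesis by (simp add: exp_sum[symmetric] sum_distrib_left sum_negf)
  qed
  have meas: "(\<lambda>f. \<Sum>b\<in>Basis. f b *\<^sub>R b) \<in> ?P \<rightarrow>\<^sub>M (borel :: 'a measure)"
    by measurable
  have gm: "(\<lambda>z::'a. exp (- a * (norm z)\<^sup>2)) \<in> borel_measurable borel" by measurable
  have "integrable ?P (\<lambda>f. \<Prod>b\<in>Basis. exp (- a * (f b)\<^sup>2))"
    by (rule product_integrable_prod) (use ints in auto)
  then have "integrable (distr ?P borel (\<lambda>f. \<Sum>b\<in>Basis. f b *\<^sub>R b)) (\<lambda>z::'a. exp (- a * (norm z)\<^sup>2))"
    unfolding integrable_distr_eq[OF meas gm] norm_sum .
  then show "integrable lborel (\<lambda>z::'a. exp (- a * (norm z)\<^sup>2))" unfolding lborel_eq[symmetric] .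
  have "(\<integral>z. exp (- a * (norm (z::'a))\<^sup>2) \<partial>lborel)
      = (\<integral>z. exp (- a * (norm (z::'a))\<^sup>2) \<partial>distr ?P borel (\<lambda>f. \<Sum>b\<in>Basis. f b *\<^sub>R b))"
    unfolding lborel_eq[symmetric] ..
  also have "\<dots> = (\<integral>f. (\<Prod>b\<in>Basis. exp (- a * (f b)\<^sup>2)) \<partial>?P)"
    unfolding integral_distr[OF meas gm] norm_sum ..
  also have "\<dots> = sqrt (pi / a) ^ DIM('a)"
    using product_integral_prod[of Basis "\<lambda>_ x. exp (- a * x\<^sup>2)"] ints by simp
  also have "\<dots> = (pi / a) powr (real DIM('a) / 2)"
    using assms by (simp add: powr_half_sqrt[symmetric] powr_realpow[symmetric] powr_powr)
  finally show "(\<integral>z. exp (- a * (norm (z::'a))\<^sup>2) \<partial>lborel) = (pi / a) powr (real DIM('a) / 2)" .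
qed

lemma mult_exp_bound:
  fixes a r :: real
  assumes "a > 0" "r \<ge> 0"
  shows "r * exp (- a * r) \<le> 2 / a * exp (- (a / 2) * r)"
proof -
  have "(a / 2 * r) * exp (- (a / 2) * r) \<le> 1"
    using exp_ge_add_one_self[of "a / 2 * r"] by (simp add: exp_minus field_simps)
  then have "(a / 2 * r) * exp (- (a / 2) * r) * exp (- (a / 2) * r) \<le> 1 * exp (- (a / 2) * r)"
    by (rule mult_right_mono) auto
  also have "(a / 2 * r) * exp (- (a / 2) * r) * exp (- (a / 2) * r) = a / 2 * (r * exp (- a * r))"
    by (simp add: mult.assoc exp_add[symmetric])
  finally show ?thesis using assms by (simp add: field_simps)
qed

lemma gauss_moment_integrable:
  assumes "a > 0"
  shows "integrable lborel (\<lambda>z::'a::euclidean_space. (norm z)\<^sup>2 * exp (- a * (norm z)\<^sup>2))"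
proof (rule Bochner_Integration.integrable_bound)
  show "integrable lborel (\<lambda>z::'a. 2 / a * exp (- (a / 2) * (norm z)\<^sup>2))"
    using gauss_euclidean(1)[of "a / 2"] assms by (intro integrable_mult_right) auto
  show "AE z in lborel. norm ((norm (z::'a))\<^sup>2 * exp (- a * (norm z)\<^sup>2)) \<le> norm (2 / a * exp (- (a / 2) * (norm z)\<^sup>2))"
    using mult_exp_bound[OF assms] assms by (intro AE_I2) (simp add: abs_mult)
qed auto

text \<open>Translation invariance, for integrands that need not be integrable.\<close>

lemma lborel_shift:
  fixes f :: "'a::euclidean_space \<Rightarrow> real"
  assumes "f \<in> borel_measurable borel"
  shows "(\<integral>y. f y \<partial>lborel) = (\<integral>z. f (p + z) \<partial>lborel)"
proof -
  have "(\<integral>z. f (p + z) \<partial>lborel) = (\<integral>y. f y \<partial>distr lborel borel ((+) p))"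
    by (rule integral_distr[symmetric]) (use assms in auto)
  then show ?thesis unfolding lborel_distr_plus ..
qed

section \<open>The Gaussian semigroup on bounded continuous functions\<close>

lemma integrable_times_bounded:
  fixes f g :: "'a \<Rightarrow> real"
  assumes "integrable M f" "g \<in> borel_measurable M" "\<And>x. \<bar>g x\<bar> \<le> C"
  shows "integrable M (\<lambda>x. f x * g x)"
proof (rule Bochner_Integration.integrable_bound)
  show "integrable M (\<lambda>x. C * f x)" using assms(1) by simp
  show "AE x in M. norm (f x * g x) \<le> norm (C * f x)"
  proof (rule AE_I2)
    fix x
    have "\<bar>g x\<bar> * \<bar>f x\<bar> \<le> \<bar>C\<bar> * \<bar>f x\<bar>"
      using assms(3)[of x] by (intro mult_right_mono) auto
    then show "norm (f x * g x) \<le> norm (C * f x)" by (simp add: abs_mult mult.commute)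
  qed
qed (use assms in auto)

lemma continuous_shift_measurable:
  fixes u :: "'a::euclidean_space \<Rightarrow> real"
  assumes "continuous_on UNIV u"
  shows "(\<lambda>z. u (p + z)) \<in> borel_measurable borel"
  by (intro borel_measurable_continuous_onI continuous_on_compose2[OF assms] continuous_intros) auto

lemma gauss_times_integrable:
  fixes u :: "'a::euclidean_space \<Rightarrow> real"
  assumes "continuous_on UNIV u" "\<And>x. \<bar>u x\<bar> \<le> C" "a > 0"
  shows "integrable lborel (\<lambda>z. exp (- a * (norm z)\<^sup>2) * u (p + z))"
    and "integrable lborel (\<lambda>z. ((norm z)\<^sup>2 * exp (- a * (norm z)\<^sup>2)) * u (p + z))"
  using continuous_shift_measurable[OF assms(1), of p] assms(2)
  by (intro integrable_times_bounded[of _ _ _ C] gauss_euclidean gauss_moment_integrable assms(3); simp)+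

lemma gaussian_semigroup_eq:
  fixes u :: "'a::euclidean_space \<Rightarrow> real"
  assumes "continuous_on UNIV u" "t > 0"
  shows "gaussian_semigroup t u x = (4 * pi * t) powr (- (real DIM('a) / 2)) *
     (\<integral>z. exp (- (1 / (4 * t)) * (norm z)\<^sup>2) * u (x + z) \<partial>lborel)"
proof -
  have um: "u \<in> borel_measurable borel" using assms by (intro borel_measurable_continuous_onI)
  then have m: "(\<lambda>y. exp (- (norm (x - y))\<^sup>2 / (4 * t)) * u y) \<in> borel_measurable borel" by measurable
  then have "(\<integral>y. exp (- (norm (x - y))\<^sup>2 / (4 * t)) * u y \<partial>lebesgue)
      = (\<integral>y. exp (- (norm (x - y))\<^sup>2 / (4 * t)) * u y \<partial>lborel)"
    by (intro integral_completion) simp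
  also have "\<dots> = (\<integral>z. exp (- (norm (x - (x + z)))\<^sup>2 / (4 * t)) * u (x + z) \<partial>lborel)"
    by (rule lborel_shift[OF m])
  finally show ?thesis using assms(2) by (simp add: gaussian_semigroup_def)
qed

lemma gauss_mass:
  assumes "t > 0"
  shows "(4 * pi * t) powr (- (real DIM('a) / 2)) *
     (\<integral>z. exp (- (1 / (4 * t)) * (norm (z::'a::euclidean_space))\<^sup>2) \<partial>lborel) = 1"
proof -
  have "pi / (1 / (4 * t)) = 4 * pi * t" using assms by simp
  moreover have "1 / (4 * t) > 0" using assms by simp
  ultimately have "(\<integral>z. exp (- (1 / (4 * t)) * (norm (z::'a))\<^sup>2) \<partial>lborel) = (4 * pi * t) powr (real DIM('a) / 2)"
    using assms gauss_euclidean(2)[where 'a = 'a, of "1 / (4 * t)"] by metis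
  then show ?thesis
    using assms by (simp add: powr_add[symmetric])
qed

lemma gaussian_semigroup_bound:
  fixes u :: "'a::euclidean_space \<Rightarrow> real"
  assumes "continuous_on UNIV u" "\<And>x. \<bar>u x\<bar> \<le> C" "t \<ge> 0"
  shows "\<bar>gaussian_semigroup t u x\<bar> \<le> C"
proof (cases "t = 0")
  case False
  then have t: "t > 0" using assms by simp
  define c where "c = (4 * pi * t) powr (- (real DIM('a) / 2))"
  define k where "k z = exp (- (1 / (4 * t)) * (norm (z::'a))\<^sup>2)" for z
  have k: "integrable lborel k" "c * (\<integral>z. k z \<partial>lborel) = 1"
    unfolding k_def[abs_def] c_def by (intro gauss_euclidean gauss_mass; use t in simp)+
  have "\<bar>\<integral>z. k z * u (x + z) \<partial>lborel\<bar> \<le> (\<integral>z. C * k z \<partial>lborel)"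
  proof (rule integral_abs_bound_integral)
    show "integrable lborel (\<lambda>z. k z * u (x + z))"
      unfolding k_def by (rule gauss_times_integrable(1)[OF assms(1,2)]) (use t in simp)
    show "\<bar>k z * u (x + z)\<bar> \<le> C * k z" for z
      using assms(2)[of "x + z"] by (simp add: k_def abs_mult mult.commute)
  qed (use k(1) in simp)
  then have "c * \<bar>\<integral>z. k z * u (x + z) \<partial>lborel\<bar> \<le> c * (C * (\<integral>z. k z \<partial>lborel))"
    by (intro mult_left_mono) (auto simp: c_def)
  also have "\<dots> = C" using k(2) by (simp add: algebra_simps)
  finally show ?thesis
    unfolding gaussian_semigroup_eq[OF assms(1) t] c_def[symmetric] k_def[symmetric]
    by (simp add: abs_mult c_def)
qed (use assms in \<open>simp add: gaussian_semigroup_def\<close>)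

lemma gaussian_semigroup_linear:
  fixes u v :: "'a::euclidean_space \<Rightarrow> real"
  assumes "continuous_on UNIV u" "\<And>x. \<bar>u x\<bar> \<le> C" "continuous_on UNIV v" "\<And>x. \<bar>v x\<bar> \<le> C'"
    and "t \<ge> 0"
  shows "gaussian_semigroup t (\<lambda>x. a * u x + b * v x) x
    = a * gaussian_semigroup t u x + b * gaussian_semigroup t v x"
proof (cases "t = 0")
  case False
  then have t: "t > 0" "1 / (4 * t) > 0" using assms by simp_all
  have c: "continuous_on UNIV (\<lambda>x. a * u x + b * v x)" by (intro continuous_intros assms)
  note int = gauss_times_integrable(1)[OF assms(1,2) t(2), of x] gauss_times_integrable(1)[OF assms(3,4) t(2), of x]
  have "(\<integral>z. exp (- (1 / (4 * t)) * (norm z)\<^sup>2) * (a * u (x + z) + b * v (x + z)) \<partial>lborel)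
    = (\<integral>z. a * (exp (- (1 / (4 * t)) * (norm z)\<^sup>2) * u (x + z)) + b * (exp (- (1 / (4 * t)) * (norm z)\<^sup>2) * v (x + z)) \<partial>lborel)"
    by (intro Bochner_Integration.integral_cong) (auto simp: algebra_simps)
  also have "\<dots> = a * (\<integral>z. exp (- (1 / (4 * t)) * (norm z)\<^sup>2) * u (x + z) \<partial>lborel)
      + b * (\<integral>z. exp (- (1 / (4 * t)) * (norm z)\<^sup>2) * v (x + z) \<partial>lborel)"
    using int by simp
  finally show ?thesis
    unfolding gaussian_semigroup_eq[OF c t(1)] gaussian_semigroup_eq[OF assms(1) t(1)]
      gaussian_semigroup_eq[OF assms(3) t(1)] by (simp add: algebra_simps)
qed (simp add: gaussian_semigroup_def)

lemma gaussian_semigroup_continuous: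
  fixes u :: "'a::euclidean_space \<Rightarrow> real"
  assumes "continuous_on UNIV u" "\<And>x. \<bar>u x\<bar> \<le> C" "t \<ge> 0"
  shows "continuous_on UNIV (gaussian_semigroup t u)"
proof (cases "t = 0")
  case True
  then have "gaussian_semigroup t u = u" by (auto simp: gaussian_semigroup_def)
  then show ?thesis using assms by simp
next
  case False
  then have t: "t > 0" "1 / (4 * t) > 0" using assms by simp_all
  let ?k = "\<lambda>z::'a. exp (- (1 / (4 * t)) * (norm z)\<^sup>2)"
  have "(\<lambda>n. \<integral>z. ?k z * u (X n + z) \<partial>lborel) \<longlonglongrightarrow> (\<integral>z. ?k z * u (x + z) \<partial>lborel)"
    if X: "X \<longlonglongrightarrow> x" for X x
  proof (rule integral_dominated_convergence[where w = "\<lambda>z. C * ?k z"])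
    show "integrable lborel (\<lambda>z. C * ?k z)"
      by (intro integrable_mult_right gauss_euclidean t)
    show "AE z in lborel. (\<lambda>n. ?k z * u (X n + z)) \<longlonglongrightarrow> ?k z * u (x + z)"
    proof (intro AE_I2 tendsto_mult tendsto_const)
      fix z
      show "(\<lambda>n. u (X n + z)) \<longlonglongrightarrow> u (x + z)"
        by (rule continuous_on_tendsto_compose[OF assms(1)]) (auto intro: tendsto_intros X)
    qed
    show "AE z in lborel. norm (?k z * u (X n + z)) \<le> C * ?k z" for n
      using assms(2) by (intro AE_I2) (auto simp: abs_mult mult.commute intro!: mult_right_mono)
  qed (rule borel_measurable_integrable gauss_times_integrable(1)[OF assms(1,2) t(2)])+
  then show ?thesis
    unfolding gaussian_semigroup_eq[OF assms(1) t(1), abs_def]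
    by (intro continuous_on_mult continuous_on_const)
       (auto simp: continuous_on_sequentially o_def)
qed

lemma gaussian_semigroup_approx:
  fixes u :: "'a::euclidean_space \<Rightarrow> real"
  assumes "continuous_on UNIV u" "\<And>x. \<bar>u x\<bar> \<le> C" "bounded S" "\<epsilon> > 0"
  obtains t0 where "t0 > 0" "\<And>t x. 0 \<le> t \<Longrightarrow> t < t0 \<Longrightarrow> x \<in> S \<Longrightarrow> \<bar>gaussian_semigroup t u x - u x\<bar> \<le> \<epsilon>"
proof -
  obtain \<rho> where \<rho>: "\<forall>x\<in>S. norm x \<le> \<rho>"
    using assms(3) by (auto simp: bounded_iff)
  have "uniformly_continuous_on (cball 0 (\<rho> + 1)) u"
    by (intro compact_uniformly_continuous continuous_on_subset[OF assms(1)]) auto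
  from this[unfolded uniformly_continuous_on_def, rule_format, of "\<epsilon> / 2"] assms(4)
  obtain \<delta>' where \<delta>': "\<delta>' > 0" "\<And>x y. x \<in> cball 0 (\<rho> + 1) \<Longrightarrow> y \<in> cball 0 (\<rho> + 1) \<Longrightarrow>
      dist y x < \<delta>' \<Longrightarrow> dist (u y) (u x) < \<epsilon> / 2"
    by auto
  define \<delta> where "\<delta> = min \<delta>' 1"
  have \<delta>: "\<delta> > 0" using \<delta>' by (simp add: \<delta>_def)
  have near: "\<bar>u (x + z) - u x\<bar> \<le> \<epsilon> / 2" if "x \<in> S" "norm z < \<delta>" for x z
  proof -
    have "norm x \<le> \<rho>" using that \<rho> by auto
    moreover have "norm (x + z) \<le> norm x + norm z" by (rule norm_triangle_ineq)
    ultimately have "norm x \<le> \<rho> + 1" "norm (x + z) \<le> \<rho> + 1"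
      using that(2) by (auto simp: \<delta>_def)
    then have "dist (u (x + z)) (u x) < \<epsilon> / 2"
      using that(2) by (intro \<delta>'(2)) (auto simp: \<delta>_def mem_cball_0 dist_norm simp del: mem_cball)
    then show ?thesis by (simp add: dist_real_def)
  qed
  have C: "C \<ge> 0" using assms(2)[of undefined] by linarith
  define D where "D = 2 * C * 2 powr (real DIM('a) / 2)"
  have D: "D \<ge> 0" using C by (simp add: D_def)
  \<comment> \<open>By \<open>exp (- s) \<le> 1 / s\<close>, points at distance at least \<open>\<delta>\<close> contribute at most
    \<open>D * (8 * t / \<delta>\<^sup>2)\<close>.\<close>
  define t0 where "t0 = \<epsilon> / 2 * \<delta>\<^sup>2 / (8 * (D + 1))"
  have t0: "t0 > 0" using \<delta> D assms(4) by (simp add: t0_def)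
  have "\<bar>gaussian_semigroup t u x - u x\<bar> \<le> \<epsilon>" if t': "0 \<le> t" "t < t0" and x: "x \<in> S" for t x
  proof (cases "t = 0")
    case False
    then have t: "t > 0" using t' by simp
    define a where "a = 1 / (4 * t)"
    have a: "a > 0" using t by (simp add: a_def)
    define c where "c = (4 * pi * t) powr (- (real DIM('a) / 2))"
    define k where "k b z = exp (- b * (norm (z::'a))\<^sup>2)" for b z
    have kint: "integrable lborel (k b)" if "b > 0" for b
      unfolding k_def[abs_def] using that by (rule gauss_euclidean)
    have mass: "c * (\<integral>z. k a z \<partial>lborel) = 1"
      unfolding k_def a_def c_def by (rule gauss_mass[OF t])
    have mass2: "c * (\<integral>z. k (a / 2) z \<partial>lborel) = 2 powr (real DIM('a) / 2)"
    proof -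
      have eq: "pi / (a / 2) = 2 * (pi / a)" by simp
      have "(\<integral>z. k (a / 2) z \<partial>lborel) = 2 powr (real DIM('a) / 2) * (\<integral>z. k a z \<partial>lborel)"
        unfolding k_def gauss_euclidean(2)[OF a] gauss_euclidean(2)[OF half_gt_zero[OF a]] eq
        by (rule powr_mult)
      then show ?thesis using mass by (simp add: algebra_simps)
    qed
    have uint: "integrable lborel (\<lambda>z. k a z * u (x + z))"
      unfolding k_def by (rule gauss_times_integrable(1)[OF assms(1,2) a])
    \<comment> \<open>Far from \<open>0\<close>, half of the exponent is given up for the small factor
      \<open>exp (- a \<delta>\<^sup>2 / 2)\<close>.\<close>
    have pt: "\<bar>k a z * u (x + z) - k a z * u x\<bar> \<le> \<epsilon> / 2 * k a z + 2 * C * exp (- (a / 2) * \<delta>\<^sup>2) * k (a / 2) z" for z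
    proof (cases "norm z < \<delta>")
      case True
      have "\<bar>k a z * u (x + z) - k a z * u x\<bar> = \<bar>u (x + z) - u x\<bar> * k a z"
        by (simp add: right_diff_distrib[symmetric] abs_mult k_def)
      also have "\<dots> \<le> \<epsilon> / 2 * k a z" using near[OF x True] by (intro mult_right_mono) (auto simp: k_def)
      also have "\<dots> \<le> \<epsilon> / 2 * k a z + 2 * C * exp (- (a / 2) * \<delta>\<^sup>2) * k (a / 2) z" using C by (simp add: k_def)
      finally show ?thesis .
    next
      case False
      then have "\<delta>\<^sup>2 \<le> (norm z)\<^sup>2" using \<delta> by (intro power_mono) auto
      then have "a / 2 * \<delta>\<^sup>2 \<le> a / 2 * (norm z)\<^sup>2" using a by (intro mult_left_mono) auto
      then have "k a z \<le> exp (- (a / 2) * \<delta>\<^sup>2) * k (a / 2) z"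
        by (simp add: k_def exp_add[symmetric])
      moreover have "\<bar>k a z * u (x + z) - k a z * u x\<bar> \<le> 2 * C * k a z"
      proof -
        have "\<bar>u (x + z) - u x\<bar> \<le> 2 * C" using assms(2)[of x] assms(2)[of "x + z"] by linarith
        then have "k a z * \<bar>u (x + z) - u x\<bar> \<le> k a z * (2 * C)"
          by (intro mult_left_mono) (auto simp: k_def)
        then show ?thesis
          unfolding right_diff_distrib[symmetric] by (simp add: abs_mult k_def mult.commute)
      qed
      ultimately have "\<bar>k a z * u (x + z) - k a z * u x\<bar> \<le> 2 * C * (exp (- (a / 2) * \<delta>\<^sup>2) * k (a / 2) z)"
        using C by (meson mult_left_mono order_trans mult_nonneg_nonneg zero_le_numeral)
      moreover have "0 \<le> \<epsilon> / 2 * k a z" using assms(4) by (simp add: k_def)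
      ultimately show ?thesis by linarith
    qed
    have "gaussian_semigroup t u x - u x = c * (\<integral>z. k a z * u (x + z) \<partial>lborel) - (c * (\<integral>z. k a z \<partial>lborel)) * u x"
      unfolding mass gaussian_semigroup_eq[OF assms(1) t] by (simp add: c_def k_def a_def)
    also have "\<dots> = c * (\<integral>z. k a z * u (x + z) - k a z * u x \<partial>lborel)"
      using uint kint[OF a] by (simp add: algebra_simps)
    also have "\<bar>\<dots>\<bar> = c * \<bar>\<integral>z. k a z * u (x + z) - k a z * u x \<partial>lborel\<bar>"
      by (simp add: abs_mult c_def)
    also have "\<dots> \<le> c * (\<integral>z. \<epsilon> / 2 * k a z + 2 * C * exp (- (a / 2) * \<delta>\<^sup>2) * k (a / 2) z \<partial>lborel)"
    proof (intro mult_left_mono integral_abs_bound_integral)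
      show "integrable lborel (\<lambda>z. k a z * u (x + z) - k a z * u x)"
        by (intro Bochner_Integration.integrable_diff integrable_mult_left uint kint a)
      show "integrable lborel (\<lambda>z. \<epsilon> / 2 * k a z + 2 * C * exp (- (a / 2) * \<delta>\<^sup>2) * k (a / 2) z)"
        by (intro Bochner_Integration.integrable_add integrable_mult_right kint) (use a in auto)
    qed (use pt in \<open>auto simp: c_def\<close>)
    also have "\<dots> = \<epsilon> / 2 * (c * (\<integral>z. k a z \<partial>lborel)) + 2 * C * exp (- (a / 2) * \<delta>\<^sup>2) * (c * (\<integral>z. k (a / 2) z \<partial>lborel))"
      using kint[of a] kint[of "a / 2"] a by (simp add: algebra_simps)
    also have "\<dots> = \<epsilon> / 2 + D * exp (- (a / 2) * \<delta>\<^sup>2)"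
      unfolding mass mass2 by (simp add: D_def)
    also have "D * exp (- (a / 2) * \<delta>\<^sup>2) \<le> (D + 1) * (8 * t / \<delta>\<^sup>2)"
    proof (rule mult_mono)
      have "exp (- (a / 2) * \<delta>\<^sup>2) * (a / 2 * \<delta>\<^sup>2) \<le> 1"
        using exp_ge_add_one_self[of "a / 2 * \<delta>\<^sup>2"] by (simp add: exp_minus field_simps)
      then show "exp (- (a / 2) * \<delta>\<^sup>2) \<le> 8 * t / \<delta>\<^sup>2"
        using t \<delta> by (simp add: a_def field_simps)
    qed (use D t in auto)
    also have "(D + 1) * (8 * t / \<delta>\<^sup>2) \<le> \<epsilon> / 2"
      using t' D \<delta> by (simp add: t0_def field_simps)
    finally show ?thesis by simp
  qed (use assms in \<open>simp add: gaussian_semigroup_def\<close>)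
  with t0 that show ?thesis by blast
qed

section \<open>The Gaussian semigroup and the distributional Laplacian\<close>

text \<open>The Laplacian of \<open>y \<mapsto> cutoff_gauss a R |y - p|\<^sup>2\<close> in dimension \<open>d\<close>, as a function of \<open>r = |y - p|\<^sup>2\<close>.\<close>

definition cutoff_laplacian :: "real \<Rightarrow> real \<Rightarrow> real \<Rightarrow> real \<Rightarrow> real" where
  "cutoff_laplacian d a R r =
     (4 * r * (bump 2 (1 - r / R) / R\<^sup>2 + 2 * a * bump 1 (1 - r / R) / R + a\<^sup>2 * bump 0 (1 - r / R))
      + 2 * d * (- bump 1 (1 - r / R) / R - a * bump 0 (1 - r / R))) * exp (- a * r)"

lemma laplacian_cutoff_gauss:
  fixes p y :: "'a::euclidean_space"
  shows "laplacian (\<lambda>y. cutoff_gauss a R ((norm (y - p))\<^sup>2)) y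
    = cutoff_laplacian (real DIM('a)) a R ((norm (y - p))\<^sup>2)"
  by (subst laplacian_radial[OF cutoff_gauss_DERIV cutoff_gauss_DERIV2])
     (simp add: cutoff_laplacian_def algebra_simps)

lemma bump_measurable [measurable]: "bump j \<in> borel_measurable borel"
  by (intro borel_measurable_continuous_onI continuous_at_imp_continuous_on ballI bump_isCont)

lemma cutoff_measurable [measurable]:
  "cutoff_gauss a R \<in> borel_measurable borel" "cutoff_laplacian d a R \<in> borel_measurable borel"
  unfolding cutoff_gauss_def[abs_def] cutoff_laplacian_def[abs_def] by measurable

lemma cutoff_tendsto:
  shows "(\<lambda>n. cutoff_gauss a (real (Suc n)) r) \<longlonglongrightarrow> exp (- a * r)"
    and "(\<lambda>n. cutoff_laplacian d a (real (Suc n)) r) \<longlonglongrightarrow> (4 * a\<^sup>2 * r - 2 * d * a) * exp (- a * r)"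
proof -
  have inv: "(\<lambda>n. c / real (Suc n)) \<longlonglongrightarrow> 0" for c
    using tendsto_mult[OF tendsto_const[of c] LIMSEQ_inverse_real_of_nat] by (simp add: divide_inverse)
  have b: "(\<lambda>n. bump j (1 - r / real (Suc n))) \<longlonglongrightarrow> bump j 1" for j
    by (rule isCont_tendsto_compose[OF bump_isCont]) (rule tendsto_eq_intros inv refl | simp)+
  have bd: "(\<lambda>n. c * bump j (1 - r / real (Suc n)) / real (Suc n)) \<longlonglongrightarrow> 0" for c j
    using tendsto_mult[OF tendsto_mult[OF tendsto_const[of c] b[of j]] inv[of 1]] by simp
  have bdd: "(\<lambda>n. bump j (1 - r / real (Suc n)) / (real (Suc n))\<^sup>2) \<longlonglongrightarrow> 0" for j
    using tendsto_mult[OF bd[of 1 j] inv[of 1]] by (simp add: power2_eq_square)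
  have "(\<lambda>n. bump 0 (1 - r / real (Suc n)) * exp (- a * r)) \<longlonglongrightarrow> bump 0 1 * exp (- a * r)"
    by (intro tendsto_mult b tendsto_const)
  then show "(\<lambda>n. cutoff_gauss a (real (Suc n)) r) \<longlonglongrightarrow> exp (- a * r)"
    by (simp add: cutoff_gauss_def bump_1)
  have "(\<lambda>n. (4 * r * (bump 2 (1 - r / real (Suc n)) / (real (Suc n))\<^sup>2 + 2 * a * bump 1 (1 - r / real (Suc n)) / real (Suc n)
        + a\<^sup>2 * bump 0 (1 - r / real (Suc n)))
      + 2 * d * ((- 1) * bump 1 (1 - r / real (Suc n)) / real (Suc n) - a * bump 0 (1 - r / real (Suc n)))) * exp (- a * r))
     \<longlonglongrightarrow> (4 * r * (0 + 0 + a\<^sup>2 * bump 0 1) + 2 * d * (0 - a * bump 0 1)) * exp (- a * r)"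
    by (intro tendsto_add tendsto_mult tendsto_diff tendsto_const b bd bdd)
  then show "(\<lambda>n. cutoff_laplacian d a (real (Suc n)) r) \<longlonglongrightarrow> (4 * a\<^sup>2 * r - 2 * d * a) * exp (- a * r)"
    by (simp add: cutoff_laplacian_def bump_1 algebra_simps)
qed

lemma cutoff_bound:
  assumes "a \<ge> 0" "d \<ge> 0"
  obtains B where "B \<ge> 0"
    "\<And>R r. R \<ge> 1 \<Longrightarrow> r \<ge> 0 \<Longrightarrow> \<bar>cutoff_gauss a R r\<bar> \<le> B * exp (- a * r)"
    "\<And>R r. R \<ge> 1 \<Longrightarrow> r \<ge> 0 \<Longrightarrow> \<bar>cutoff_laplacian d a R r\<bar> \<le> B * (r * exp (- a * r)) + B * exp (- a * r)"
proof -
  obtain B0 B1 B2 where B0: "B0 \<ge> 0" "\<And>s. s \<le> 1 \<Longrightarrow> \<bar>bump 0 s\<bar> \<le> B0"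
    and B1: "B1 \<ge> 0" "\<And>s. s \<le> 1 \<Longrightarrow> \<bar>bump 1 s\<bar> \<le> B1"
    and B2: "B2 \<ge> 0" "\<And>s. s \<le> 1 \<Longrightarrow> \<bar>bump 2 s\<bar> \<le> B2"
    using bump_bounded[of 0] bump_bounded[of 1] bump_bounded[of 2] by blast
  define P where "P = 4 * (B2 + 2 * a * B1 + a\<^sup>2 * B0)"
  define Q where "Q = 2 * d * (B1 + a * B0)"
  define B where "B = max B0 (max P Q)"
  have PQ: "P \<ge> 0" "Q \<ge> 0" using assms B0 B1 B2 by (auto simp: P_def Q_def)
  have B: "B0 \<le> B" "P \<le> B" "Q \<le> B" by (auto simp: B_def)
  have div: "\<bar>x / R\<bar> \<le> c" "\<bar>x / R\<^sup>2\<bar> \<le> c" if "R \<ge> 1" "\<bar>x\<bar> \<le> c" for x R c :: real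
  proof -
    have "\<bar>x\<bar> \<le> c * R" "\<bar>x\<bar> \<le> c * R\<^sup>2"
      using that mult_mono[of "\<bar>x\<bar>" c 1 R] mult_mono[of "\<bar>x\<bar>" c 1 "R\<^sup>2"] one_le_power[of R 2] by auto
    then show "\<bar>x / R\<bar> \<le> c" "\<bar>x / R\<^sup>2\<bar> \<le> c" using that by (auto simp: abs_div pos_divide_le_eq)
  qed
  show ?thesis
  proof (rule that[of B])
    show "B \<ge> 0" using B0 by (simp add: B_def)
    fix R r :: real assume R: "R \<ge> 1" and r: "r \<ge> 0"
    define s where "s = 1 - r / R"
    have s: "s \<le> 1" using R r by (simp add: s_def)
    have "\<bar>cutoff_gauss a R r\<bar> = \<bar>bump 0 s\<bar> * exp (- a * r)" by (simp add: cutoff_gauss_def s_def abs_mult)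
    also have "\<dots> \<le> B * exp (- a * r)"
      using B0(2)[OF s] B by (intro mult_right_mono) auto
    finally show "\<bar>cutoff_gauss a R r\<bar> \<le> B * exp (- a * r)" .
    have bd1: "\<bar>bump 2 s / R\<^sup>2\<bar> \<le> B2" "\<bar>bump 1 s / R\<bar> \<le> B1"
      using div R B1(2)[OF s] B2(2)[OF s] by auto
    have bd3: "\<bar>2 * a * bump 1 s / R\<bar> \<le> 2 * a * B1"
      using div[OF R B1(2)[OF s]] assms(1) by (simp add: abs_mult abs_div mult.assoc mult_left_mono flip: times_divide_eq_right)
    have bd4: "\<bar>a\<^sup>2 * bump 0 s\<bar> \<le> a\<^sup>2 * B0" "\<bar>a * bump 0 s\<bar> \<le> a * B0"
      using B0(2)[OF s] assms(1) by (auto simp: abs_mult intro!: mult_left_mono)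
    note bds = bd1 bd3 bd4
    have sum3: "\<bar>x + y + z\<bar> \<le> p + q + l" if "\<bar>x\<bar> \<le> p" "\<bar>y\<bar> \<le> q" "\<bar>z\<bar> \<le> l" for x y z p q l :: real
      using that by linarith
    have diff2: "\<bar>- x / R - z\<bar> \<le> p + l" if "\<bar>x / R\<bar> \<le> p" "\<bar>z\<bar> \<le> l" for x z p l :: real
      using that unfolding minus_divide_left[symmetric] by linarith
    have 1: "\<bar>bump 2 s / R\<^sup>2 + 2 * a * bump 1 s / R + a\<^sup>2 * bump 0 s\<bar> \<le> P / 4"
      using sum3[OF bds(1,3,4)] by (simp add: P_def)
    have 2: "\<bar>- bump 1 s / R - a * bump 0 s\<bar> \<le> B1 + a * B0"
      by (rule diff2[OF bds(2,5)])
    have 3: "\<bar>4 * r * (bump 2 s / R\<^sup>2 + 2 * a * bump 1 s / R + a\<^sup>2 * bump 0 s)\<bar> \<le> P * r"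
    proof -
      have "\<bar>4 * r * Z\<bar> \<le> P * r" if "\<bar>Z\<bar> \<le> P / 4" for Z
        using mult_left_mono[OF that, of "4 * r"] r by (simp add: abs_mult mult_ac)
      then show ?thesis using 1 .
    qed
    have 4: "\<bar>2 * d * (- bump 1 s / R - a * bump 0 s)\<bar> \<le> Q"
      using mult_left_mono[OF 2, of "2 * d"] assms(2) by (simp add: abs_mult Q_def)
    have "P * r \<le> B * r" using B r by (intro mult_right_mono) auto
    then have "\<bar>4 * r * (bump 2 s / R\<^sup>2 + 2 * a * bump 1 s / R + a\<^sup>2 * bump 0 s)
        + 2 * d * (- bump 1 s / R - a * bump 0 s)\<bar> \<le> B * r + B"
      using 3 4 B by linarith
    then have "\<bar>cutoff_laplacian d a R r\<bar> \<le> (B * r + B) * exp (- a * r)"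
      unfolding cutoff_laplacian_def s_def[symmetric] by (simp add: abs_mult mult_right_mono)
    then show "\<bar>cutoff_laplacian d a R r\<bar> \<le> B * (r * exp (- a * r)) + B * exp (- a * r)"
      by (simp add: algebra_simps)
  qed
qed

text \<open>
  The equation \<open>\<Delta>w = g\<close> tested with the Gaussian \<open>exp (- a |y - p|\<^sup>2)\<close>, whose Laplacian is
  \<open>(4 a\<^sup>2 |y - p|\<^sup>2 - 2 a d) exp (- a |y - p|\<^sup>2)\<close> in dimension \<open>d\<close>; the limit \<open>R \<rightarrow> \<infinity>\<close> of the
  cut-off Gaussians.
\<close>

lemma gauss_weak:
  fixes w g :: "'a::euclidean_space \<Rightarrow> real"
  assumes w: "continuous_on UNIV w" "\<And>x. \<bar>w x\<bar> \<le> C" and g: "continuous_on UNIV g" "\<And>x. \<bar>g x\<bar> \<le> C"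
    and lap: "distr_laplacian UNIV w g" and a: "a > 0"
  shows "4 * a\<^sup>2 * (\<integral>z. ((norm z)\<^sup>2 * exp (- a * (norm z)\<^sup>2)) * w (p + z) \<partial>lborel)
     - 2 * real DIM('a) * a * (\<integral>z. exp (- a * (norm z)\<^sup>2) * w (p + z) \<partial>lborel)
     = (\<integral>z. exp (- a * (norm z)\<^sup>2) * g (p + z) \<partial>lborel)"
proof -
  define d where "d = real DIM('a)"
  have C: "C \<ge> 0" using w(2)[of undefined] by linarith
  obtain B where B: "B \<ge> 0"
    "\<And>R r. R \<ge> 1 \<Longrightarrow> r \<ge> 0 \<Longrightarrow> \<bar>cutoff_gauss a R r\<bar> \<le> B * exp (- a * r)"
    "\<And>R r. R \<ge> 1 \<Longrightarrow> r \<ge> 0 \<Longrightarrow> \<bar>cutoff_laplacian d a R r\<bar> \<le> B * (r * exp (- a * r)) + B * exp (- a * r)"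
    using cutoff_bound[of a d] a by (auto simp: d_def)
  have [measurable]: "w \<in> borel_measurable borel" "g \<in> borel_measurable borel"
    using w(1) g(1) by (auto intro: borel_measurable_continuous_onI)
  have eq: "(\<integral>z. cutoff_laplacian d a (real (Suc n)) ((norm z)\<^sup>2) * w (p + z) \<partial>lborel)
      = (\<integral>z. cutoff_gauss a (real (Suc n)) ((norm z)\<^sup>2) * g (p + z) \<partial>lborel)" for n
  proof -
    let ?R = "real (Suc n)"
    have "(\<lambda>y. cutoff_gauss a ?R ((norm (y - p))\<^sup>2)) \<in> test_fun UNIV"
      by (rule cutoff_gauss_test_fun) auto
    then have "(\<integral>y. w y * cutoff_laplacian d a ?R ((norm (y - p))\<^sup>2) \<partial>lebesgue_on UNIV)
        = (\<integral>y. g y * cutoff_gauss a ?R ((norm (y - p))\<^sup>2) \<partial>lebesgue_on UNIV)"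
      using lap unfolding distr_laplacian_def laplacian_cutoff_gauss[symmetric] d_def by blast
    then have "(\<integral>y. w y * cutoff_laplacian d a ?R ((norm (y - p))\<^sup>2) \<partial>lborel)
        = (\<integral>y. g y * cutoff_gauss a ?R ((norm (y - p))\<^sup>2) \<partial>lborel)"
      by (simp add: integral_completion lebesgue_on_UNIV_eq)
    then show ?thesis
      by (subst (asm) (1 2) lborel_shift[where p = p]) (auto simp: mult.commute)
  qed
  have int: "integrable lborel (\<lambda>z::'a. B * C * ((norm z)\<^sup>2 * exp (- a * (norm z)\<^sup>2)) + B * C * exp (- a * (norm z)\<^sup>2))"
    by (intro Bochner_Integration.integrable_add integrable_mult_right gauss_moment_integrable gauss_euclidean a)
  have "(\<lambda>n. \<integral>z. cutoff_laplacian d a (real (Suc n)) ((norm z)\<^sup>2) * w (p + z) \<partial>lborel)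
      \<longlonglongrightarrow> (\<integral>z. ((4 * a\<^sup>2 * (norm z)\<^sup>2 - 2 * d * a) * exp (- a * (norm z)\<^sup>2)) * w (p + z) \<partial>lborel)"
  proof (rule integral_dominated_convergence[OF _ _ int])
    show "AE z in lborel. (\<lambda>n. cutoff_laplacian d a (real (Suc n)) ((norm z)\<^sup>2) * w (p + z))
        \<longlonglongrightarrow> ((4 * a\<^sup>2 * (norm z)\<^sup>2 - 2 * d * a) * exp (- a * (norm z)\<^sup>2)) * w (p + z)"
      by (intro AE_I2 tendsto_mult tendsto_const cutoff_tendsto)
    show "AE z in lborel. norm (cutoff_laplacian d a (real (Suc n)) ((norm z)\<^sup>2) * w (p + z))
        \<le> B * C * ((norm z)\<^sup>2 * exp (- a * (norm z)\<^sup>2)) + B * C * exp (- a * (norm z)\<^sup>2)" for n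
    proof (rule AE_I2)
      fix z :: 'a
      have "\<bar>cutoff_laplacian d a (real (Suc n)) ((norm z)\<^sup>2)\<bar> * \<bar>w (p + z)\<bar>
          \<le> (B * ((norm z)\<^sup>2 * exp (- a * (norm z)\<^sup>2)) + B * exp (- a * (norm z)\<^sup>2)) * C"
        using B(1) B(3)[of "real (Suc n)" "(norm z)\<^sup>2"] w(2)[of "p + z"] by (intro mult_mono) auto
      then show "norm (cutoff_laplacian d a (real (Suc n)) ((norm z)\<^sup>2) * w (p + z))
        \<le> B * C * ((norm z)\<^sup>2 * exp (- a * (norm z)\<^sup>2)) + B * C * exp (- a * (norm z)\<^sup>2)"
        by (simp add: abs_mult algebra_simps)
    qed
  qed measurable
  moreover have "(\<lambda>n. \<integral>z. cutoff_gauss a (real (Suc n)) ((norm z)\<^sup>2) * g (p + z) \<partial>lborel)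
      \<longlonglongrightarrow> (\<integral>z. exp (- a * (norm z)\<^sup>2) * g (p + z) \<partial>lborel)"
  proof (rule integral_dominated_convergence[where w = "\<lambda>z. B * C * exp (- a * (norm z)\<^sup>2)"])
    show "integrable lborel (\<lambda>z::'a. B * C * exp (- a * (norm z)\<^sup>2))"
      by (intro integrable_mult_right gauss_euclidean a)
    show "AE z in lborel. (\<lambda>n. cutoff_gauss a (real (Suc n)) ((norm z)\<^sup>2) * g (p + z))
        \<longlonglongrightarrow> exp (- a * (norm z)\<^sup>2) * g (p + z)"
      by (intro AE_I2 tendsto_mult tendsto_const cutoff_tendsto)
    show "AE z in lborel. norm (cutoff_gauss a (real (Suc n)) ((norm z)\<^sup>2) * g (p + z))
        \<le> B * C * exp (- a * (norm z)\<^sup>2)" for n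
    proof (rule AE_I2)
      fix z :: 'a
      have "\<bar>cutoff_gauss a (real (Suc n)) ((norm z)\<^sup>2)\<bar> * \<bar>g (p + z)\<bar> \<le> (B * exp (- a * (norm z)\<^sup>2)) * C"
        using B(1) B(2)[of "real (Suc n)" "(norm z)\<^sup>2"] g(2)[of "p + z"] by (intro mult_mono) auto
      then show "norm (cutoff_gauss a (real (Suc n)) ((norm z)\<^sup>2) * g (p + z)) \<le> B * C * exp (- a * (norm z)\<^sup>2)"
        by (simp add: abs_mult algebra_simps)
    qed
  qed measurable
  ultimately have "(\<integral>z. ((4 * a\<^sup>2 * (norm z)\<^sup>2 - 2 * d * a) * exp (- a * (norm z)\<^sup>2)) * w (p + z) \<partial>lborel)
      = (\<integral>z. exp (- a * (norm z)\<^sup>2) * g (p + z) \<partial>lborel)"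
    unfolding eq by (rule LIMSEQ_unique)
  moreover have "(\<integral>z. ((4 * a\<^sup>2 * (norm z)\<^sup>2 - 2 * d * a) * exp (- a * (norm z)\<^sup>2)) * w (p + z) \<partial>lborel)
     = (\<integral>z. 4 * a\<^sup>2 * (((norm z)\<^sup>2 * exp (- a * (norm z)\<^sup>2)) * w (p + z)) - 2 * d * a * (exp (- a * (norm z)\<^sup>2) * w (p + z)) \<partial>lborel)"
    by (intro Bochner_Integration.integral_cong) (auto simp: algebra_simps)
  moreover have "\<dots> = 4 * a\<^sup>2 * (\<integral>z. ((norm z)\<^sup>2 * exp (- a * (norm z)\<^sup>2)) * w (p + z) \<partial>lborel)
     - 2 * d * a * (\<integral>z. exp (- a * (norm z)\<^sup>2) * w (p + z) \<partial>lborel)"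
    using gauss_times_integrable[OF w a, of p]
    by (subst Bochner_Integration.integral_diff) (auto simp del: mult_minus_left simp: mult.assoc)
  ultimately show ?thesis unfolding d_def by simp
qed

lemma exp_difference_bound:
  fixes x y m :: real
  assumes "x \<le> m" "y \<le> m"
  shows "\<bar>exp x - exp y\<bar> \<le> \<bar>x - y\<bar> * exp m"
proof -
  have *: "exp x - exp y \<le> \<bar>x - y\<bar> * exp m" if "x \<le> m" for x y
  proof -
    have "exp x * (1 + (y - x)) \<le> exp x * exp (y - x)"
      by (intro mult_left_mono exp_ge_add_one_self) auto
    then have "exp x - exp y \<le> (x - y) * exp x" by (simp add: exp_diff algebra_simps)
    also have "\<dots> \<le> \<bar>x - y\<bar> * exp m" using that by (intro mult_mono) auto
    finally show ?thesis .
  qed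
  show ?thesis using *[of x y] *[of y x] assms by (auto simp: abs_minus_commute)
qed

lemma gauss_DERIV:
  fixes w :: "'a::euclidean_space \<Rightarrow> real"
  assumes w: "continuous_on UNIV w" "\<And>x. \<bar>w x\<bar> \<le> C" and a: "a > 0"
  shows "((\<lambda>a. \<integral>z. exp (- a * (norm z)\<^sup>2) * w (p + z) \<partial>lborel) has_real_derivative
     - (\<integral>z. ((norm z)\<^sup>2 * exp (- a * (norm z)\<^sup>2)) * w (p + z) \<partial>lborel)) (at a)"
proof -
  have C: "C \<ge> 0" using w(2)[of undefined] by linarith
  have [measurable]: "w \<in> borel_measurable borel"
    using w(1) by (auto intro: borel_measurable_continuous_onI)
  let ?\<Psi> = "\<lambda>a. \<integral>z. exp (- a * (norm z)\<^sup>2) * w (p + z) \<partial>lborel"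
  let ?S = "{- a / 2<..<a / 2}"
  \<comment> \<open>Increments of size at most \<open>a / 2\<close> keep the difference quotients dominated.\<close>
  have at0: "at (0::real) = at 0 within ?S" using a by (intro at_within_open[symmetric]) auto
  have "(\<lambda>n. (?\<Psi> (a + X n) - ?\<Psi> a) / X n) \<longlonglongrightarrow> (\<integral>z. (- ((norm z)\<^sup>2 * exp (- a * (norm z)\<^sup>2))) * w (p + z) \<partial>lborel)"
    if XS: "\<And>n. X n \<in> ?S - {0}" and X: "X \<longlonglongrightarrow> 0" for X
  proof -
    have "(\<lambda>n. \<integral>z. ((exp (- (a + X n) * (norm z)\<^sup>2) - exp (- a * (norm z)\<^sup>2)) / X n) * w (p + z) \<partial>lborel)
      \<longlonglongrightarrow> (\<integral>z. (- ((norm z)\<^sup>2 * exp (- a * (norm z)\<^sup>2))) * w (p + z) \<partial>lborel)"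
    proof (rule integral_dominated_convergence[where w = "\<lambda>z. C * ((norm z)\<^sup>2 * exp (- (a / 2) * (norm z)\<^sup>2))"])
      show "integrable lborel (\<lambda>z::'a. C * ((norm z)\<^sup>2 * exp (- (a / 2) * (norm z)\<^sup>2)))"
        by (intro integrable_mult_right gauss_moment_integrable) (use a in simp)
      show "AE z in lborel. (\<lambda>n. (exp (- (a + X n) * (norm z)\<^sup>2) - exp (- a * (norm z)\<^sup>2)) / X n * w (p + z))
          \<longlonglongrightarrow> - ((norm z)\<^sup>2 * exp (- a * (norm z)\<^sup>2)) * w (p + z)"
      proof (intro AE_I2 tendsto_mult tendsto_const)
        fix z :: 'a
        have "((\<lambda>a. exp (- a * (norm z)\<^sup>2)) has_real_derivative - ((norm z)\<^sup>2 * exp (- a * (norm z)\<^sup>2))) (at a)"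
          by (auto intro!: derivative_eq_intros)
        then have "((\<lambda>h. (exp (- (a + h) * (norm z)\<^sup>2) - exp (- a * (norm z)\<^sup>2)) / h) \<longlongrightarrow> - ((norm z)\<^sup>2 * exp (- a * (norm z)\<^sup>2))) (at 0)"
          unfolding DERIV_def .
        then show "(\<lambda>n. (exp (- (a + X n) * (norm z)\<^sup>2) - exp (- a * (norm z)\<^sup>2)) / X n) \<longlonglongrightarrow> - ((norm z)\<^sup>2 * exp (- a * (norm z)\<^sup>2))"
          using XS X unfolding tendsto_at_iff_sequentially o_def by blast
      qed
      show "AE z in lborel. norm ((exp (- (a + X n) * (norm z)\<^sup>2) - exp (- a * (norm z)\<^sup>2)) / X n * w (p + z))
          \<le> C * ((norm z)\<^sup>2 * exp (- (a / 2) * (norm z)\<^sup>2))" for n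
      proof (rule AE_I2)
        fix z :: 'a
        define r where "r = (norm z)\<^sup>2"
        have r: "r \<ge> 0" by (simp add: r_def)
        have X': "- a / 2 < X n" "X n < a / 2" "X n \<noteq> 0" using XS[of n] by auto
        have "- (a + X n) * r \<le> - (a / 2) * r" "- a * r \<le> - (a / 2) * r"
          using X' r a by (intro mult_right_mono; simp)+
        then have "\<bar>exp (- (a + X n) * r) - exp (- a * r)\<bar> \<le> \<bar>- (a + X n) * r - - a * r\<bar> * exp (- (a / 2) * r)"
          by (rule exp_difference_bound)
        also have "- (a + X n) * r - - a * r = - X n * r" by (simp add: algebra_simps)
        finally have "\<bar>exp (- (a + X n) * r) - exp (- a * r)\<bar> \<le> \<bar>X n\<bar> * (r * exp (- (a / 2) * r))"
          using r by (simp add: abs_mult)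
        then have "\<bar>(exp (- (a + X n) * r) - exp (- a * r)) / X n\<bar> \<le> r * exp (- (a / 2) * r)"
          using X' by (simp add: abs_div pos_divide_le_eq mult.commute)
        then have "\<bar>(exp (- (a + X n) * r) - exp (- a * r)) / X n\<bar> * \<bar>w (p + z)\<bar> \<le> (r * exp (- (a / 2) * r)) * C"
          using w(2)[of "p + z"] r by (intro mult_mono) auto
        then show "norm ((exp (- (a + X n) * (norm z)\<^sup>2) - exp (- a * (norm z)\<^sup>2)) / X n * w (p + z))
          \<le> C * ((norm z)\<^sup>2 * exp (- (a / 2) * (norm z)\<^sup>2))"
          unfolding r_def[symmetric] by (simp add: abs_mult mult.commute)
      qed
    qed measurable
    moreover have "(\<integral>z. ((exp (- (a + X n) * (norm z)\<^sup>2) - exp (- a * (norm z)\<^sup>2)) / X n) * w (p + z) \<partial>lborel)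
        = (?\<Psi> (a + X n) - ?\<Psi> a) / X n" for n
    proof -
      have "a + X n > 0" using XS[of n] a by auto
      then have "?\<Psi> (a + X n) - ?\<Psi> a = (\<integral>z. exp (- (a + X n) * (norm z)\<^sup>2) * w (p + z) - exp (- a * (norm z)\<^sup>2) * w (p + z) \<partial>lborel)"
        by (intro Bochner_Integration.integral_diff[symmetric] gauss_times_integrable(1)[OF w] a)
      then have "(?\<Psi> (a + X n) - ?\<Psi> a) / X n
        = (\<integral>z. (exp (- (a + X n) * (norm z)\<^sup>2) * w (p + z) - exp (- a * (norm z)\<^sup>2) * w (p + z)) / X n \<partial>lborel)"
        by simp
      also have "\<dots> = (\<integral>z. ((exp (- (a + X n) * (norm z)\<^sup>2) - exp (- a * (norm z)\<^sup>2)) / X n) * w (p + z) \<partial>lborel)"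
        by (intro Bochner_Integration.integral_cong) (auto simp: left_diff_distrib)
      finally show ?thesis ..
    qed
    ultimately show ?thesis by (simp only:)
  qed
  then show ?thesis
    unfolding DERIV_def at0 tendsto_at_iff_sequentially o_def by simp
qed

lemma gaussian_semigroup_DERIV:
  fixes w g :: "'a::euclidean_space \<Rightarrow> real"
  assumes w: "continuous_on UNIV w" "\<And>x. \<bar>w x\<bar> \<le> C" and g: "continuous_on UNIV g" "\<And>x. \<bar>g x\<bar> \<le> C"
    and lap: "distr_laplacian UNIV w g" and t: "t > 0"
  shows "((\<lambda>t. gaussian_semigroup t w p) has_real_derivative gaussian_semigroup t g p) (at t)"
proof -
  define d where "d = real DIM('a)"
  define a where "a = 1 / (4 * t)"
  have a: "a > 0" using t by (simp add: a_def)
  define c where "c t = (4 * pi * t) powr (- (d / 2))" for t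
  define M0 where "M0 a = (\<integral>z. exp (- a * (norm z)\<^sup>2) * w (p + z) \<partial>lborel)" for a
  define M2 where "M2 = (\<integral>z. ((norm z)\<^sup>2 * exp (- a * (norm z)\<^sup>2)) * w (p + z) \<partial>lborel)"
  have "(M0 has_real_derivative - M2) (at (1 / (4 * t)))"
    unfolding M0_def[abs_def] M2_def a_def[symmetric] by (rule gauss_DERIV[OF w a])
  moreover have "((\<lambda>t. 1 / (4 * t)) has_real_derivative - 4 * a\<^sup>2) (at t)"
    using t by (auto intro!: derivative_eq_intros simp: a_def power2_eq_square field_simps)
  ultimately have 1: "((\<lambda>t. M0 (1 / (4 * t))) has_real_derivative - M2 * (- 4 * a\<^sup>2)) (at t)"
    by (rule DERIV_chain2)
  have 2: "(c has_real_derivative - 2 * d * a * c t) (at t)"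
  proof -
    have l: "((\<lambda>t. 4 * pi * t) has_real_derivative 4 * pi) (at t)"
      by (auto intro!: derivative_eq_intros)
    have p: "4 * pi * t > 0" using t by simp
    have "((\<lambda>t. (4 * pi * t) powr (- (d / 2))) has_real_derivative
        (- (d / 2) * (4 * pi * t) powr (- (d / 2) - 1)) * (4 * pi)) (at t)"
      by (rule DERIV_chain2[OF has_real_derivative_powr[OF p] l])
    moreover have "(- (d / 2) * (4 * pi * t) powr (- (d / 2) - 1)) * (4 * pi) = - 2 * d * a * c t"
    proof -
      have "(4 * pi * t) powr (- (d / 2) - 1) = c t / (4 * pi * t)"
        unfolding powr_diff c_def using p by simp
      then show ?thesis using t by (simp add: a_def)
    qed
    ultimately show ?thesis unfolding c_def[abs_def] by metis
  qed
  have "((\<lambda>t. c t * M0 (1 / (4 * t))) has_real_derivative c t * (4 * a\<^sup>2 * M2 - 2 * d * a * M0 a)) (at t)"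
    by (rule DERIV_cong[OF DERIV_mult[OF 2 1]]) (simp add: algebra_simps a_def)
  also have "4 * a\<^sup>2 * M2 - 2 * d * a * M0 a = (\<integral>z. exp (- a * (norm z)\<^sup>2) * g (p + z) \<partial>lborel)"
    unfolding M2_def M0_def d_def by (rule gauss_weak[OF w g lap a])
  also have "c t * \<dots> = gaussian_semigroup t g p"
    unfolding gaussian_semigroup_eq[OF g(1) t] c_def a_def d_def ..
  finally show ?thesis
    by (rule has_field_derivative_transform_within_open[of _ _ _ "{0<..}"])
       (use t in \<open>auto simp: gaussian_semigroup_eq[OF w(1)] c_def M0_def d_def\<close>)
qed

lemma gaussian_semigroup_generator:
  fixes w g :: "'a::euclidean_space \<Rightarrow> real"
  assumes w: "continuous_on UNIV w" "\<And>x. \<bar>w x\<bar> \<le> C" and g: "continuous_on UNIV g" "\<And>x. \<bar>g x\<bar> \<le> C"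
    and lap: "distr_laplacian UNIV w g" and S: "bounded S" and \<epsilon>: "\<epsilon> > 0"
  obtains t0 where "t0 > 0"
    "\<And>t x. 0 < t \<Longrightarrow> t < t0 \<Longrightarrow> x \<in> S \<Longrightarrow> \<bar>(gaussian_semigroup t w x - w x) / t - g x\<bar> \<le> \<epsilon>"
proof -
  obtain t0 where t0: "t0 > 0" "\<And>t x. 0 \<le> t \<Longrightarrow> t < t0 \<Longrightarrow> x \<in> S \<Longrightarrow> \<bar>gaussian_semigroup t g x - g x\<bar> \<le> \<epsilon>"
    using gaussian_semigroup_approx[OF g S \<epsilon>] by metis
  have "\<bar>(gaussian_semigroup t w x - w x) / t - g x\<bar> \<le> \<epsilon>" if t: "0 < t" "t < t0" and x: "x \<in> S" for t x
  proof -
    let ?H = "\<lambda>s. gaussian_semigroup s w x"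
    have H0: "?H 0 = w x" by (simp add: gaussian_semigroup_def)
    have D: "(?H has_real_derivative gaussian_semigroup s g x) (at s)" if "s > 0" for s
      by (rule gaussian_semigroup_DERIV[OF w g lap that])
    have lim0: "(?H \<longlongrightarrow> w x) (at_right 0)"
    proof (rule tendstoI)
      fix e :: real assume e: "e > 0"
      obtain t1 where "t1 > 0" "\<And>t. 0 \<le> t \<Longrightarrow> t < t1 \<Longrightarrow> \<bar>gaussian_semigroup t w x - w x\<bar> \<le> e / 2"
        using gaussian_semigroup_approx[OF w S, of "e / 2"] e x by (metis half_gt_zero)
      then show "\<forall>\<^sub>F s in at_right 0. dist (?H s) (w x) < e"
        using e by (auto simp: eventually_at_right_field dist_real_def intro!: exI[of _ t1]) (smt (verit) field_sum_of_halves)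
    qed
    have "continuous_on {0..t} ?H"
    proof (rule continuous_on_IccI)
      show "(?H \<longlongrightarrow> ?H 0) (at_right 0)" using lim0 H0 by simp
      show "(?H \<longlongrightarrow> ?H t) (at_left t)"
        using D[OF t(1)] DERIV_isCont isCont_def tendsto_within_subset[of _ _ t UNIV] by (metis subset_UNIV)
      show "(?H \<longlongrightarrow> ?H s) (at s)" if "0 < s" "s < t" for s
        using D[OF that(1)] DERIV_isCont isCont_def by blast
    qed (use t in auto)
    moreover have "?H differentiable (at s)" if "0 < s" "s < t" for s
      using D[OF that(1)] real_differentiable_def by blast
    ultimately obtain l s where s: "0 < s" "s < t" "DERIV ?H s :> l" "?H t - ?H 0 = (t - 0) * l"
      using MVT[of 0 t ?H] t by blast
    have "l = gaussian_semigroup s g x" using DERIV_unique[OF s(3) D[OF s(1)]] .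
    then have "(gaussian_semigroup t w x - w x) / t = gaussian_semigroup s g x"
      using s(4) t H0 by (simp add: field_simps)
    then show ?thesis using t0(2)[of s x] s t x by simp
  qed
  with t0(1) that show ?thesis by blast
qed

section \<open>Uniqueness of the distributional Laplacian\<close>

lemma integral_lebesgue_on_support:
  fixes k :: "'a::euclidean_space \<Rightarrow> real"
  assumes "\<Omega> \<in> sets lebesgue" "\<And>x. x \<notin> \<Omega> \<Longrightarrow> k x = 0"
  shows "(\<integral>x. k x \<partial>lebesgue_on \<Omega>) = (\<integral>x. k x \<partial>lebesgue)"
proof -
  have "(\<lambda>x. indicat_real \<Omega> x *\<^sub>R k x) = k" using assms(2) by (fastforce simp: indicator_def)
  then show ?thesis using assms(1) by (simp add: integral_restrict_space)
qed

text \<open>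
  If \<open>f\<close> and \<open>g\<close> differed at a point of \<open>\<Omega>\<close>, a bump function concentrated near that point would
  detect the difference.
\<close>

lemma distr_laplacian_unique:
  fixes u f w g :: "'a::euclidean_space \<Rightarrow> real"
  assumes op: "open \<Omega>" and uf: "distr_laplacian \<Omega> u f" and wg: "distr_laplacian UNIV w g"
    and eq: "\<And>x. x \<in> \<Omega> \<Longrightarrow> w x = u x" and f: "continuous_on \<Omega> f" and g: "continuous_on UNIV g"
    and x0: "x0 \<in> \<Omega>"
  shows "f x0 = g x0"
proof (rule ccontr)
  assume ne: "f x0 \<noteq> g x0"
  define s where "s = sgn (f x0 - g x0)"
  define h where "h x = s * (f x - g x)" for x
  have hc: "continuous_on \<Omega> h"
    unfolding h_def by (intro continuous_intros f continuous_on_subset[OF g]) auto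
  have "open (\<Omega> \<inter> h -` {0<..})" by (intro continuous_open_preimage hc op) auto
  moreover have "x0 \<in> \<Omega> \<inter> h -` {0<..}"
    using ne x0 by (auto simp: h_def s_def sgn_if)
  ultimately obtain \<rho> where \<rho>: "\<rho> > 0" "cball x0 \<rho> \<subseteq> \<Omega> \<inter> h -` {0<..}"
    unfolding open_contains_cball by blast
  define \<phi> where "\<phi> = (\<lambda>y. cutoff_gauss 0 (\<rho>\<^sup>2) ((norm (y - x0))\<^sup>2))"
  have \<phi>_test: "\<phi> \<in> test_fun \<Omega>" "\<phi> \<in> test_fun UNIV"
    unfolding \<phi>_def by (rule cutoff_gauss_test_fun; use \<rho> in auto)+
  have lap0: "laplacian \<phi> y = 0" and \<phi>0: "\<phi> y = 0" if "y \<notin> ball x0 \<rho>" for y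
  proof -
    have "\<rho> \<le> norm (y - x0)" using that by (simp add: dist_norm norm_minus_commute)
    then have "\<rho>\<^sup>2 \<le> (norm (y - x0))\<^sup>2" using \<rho> by (intro power_mono) auto
    then have "1 - (norm (y - x0))\<^sup>2 / \<rho>\<^sup>2 \<le> 0" using \<rho> by (simp add: field_simps)
    then show "laplacian \<phi> y = 0" "\<phi> y = 0"
      unfolding \<phi>_def laplacian_cutoff_gauss by (auto simp: cutoff_laplacian_def cutoff_gauss_def bump_eq_0)
  qed
  have \<phi>pos: "\<phi> y > 0" if "y \<in> ball x0 \<rho>" for y
  proof -
    have "(norm (y - x0))\<^sup>2 < \<rho>\<^sup>2" using that \<rho> by (intro power_strict_mono) (auto simp: dist_norm norm_minus_commute)
    then have "1 - (norm (y - x0))\<^sup>2 / \<rho>\<^sup>2 > 0" using \<rho> by (simp add: field_simps)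
    then show ?thesis by (simp add: \<phi>_def cutoff_gauss_def bump_pos)
  qed
  have sub: "ball x0 \<rho> \<subseteq> \<Omega>" using \<rho> by force
  have \<Omega>: "\<Omega> \<in> sets lebesgue" using op by simp
  have "(\<integral>x. f x * \<phi> x \<partial>lebesgue) = (\<integral>x. f x * \<phi> x \<partial>lebesgue_on \<Omega>)"
    using \<phi>0 sub by (intro integral_lebesgue_on_support[symmetric] \<Omega>) force
  also have "\<dots> = (\<integral>x. u x * laplacian \<phi> x \<partial>lebesgue_on \<Omega>)"
    using uf \<phi>_test by (simp add: distr_laplacian_def)
  also have "\<dots> = (\<integral>x. u x * laplacian \<phi> x \<partial>lebesgue)"
    using lap0 sub by (intro integral_lebesgue_on_support \<Omega>) force
  also have "(\<lambda>x. u x * laplacian \<phi> x) = (\<lambda>x. w x * laplacian \<phi> x)"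
  proof
    show "u x * laplacian \<phi> x = w x * laplacian \<phi> x" for x
      using lap0[of x] eq[of x] sub by (cases "x \<in> ball x0 \<rho>") auto
  qed
  also have "(\<integral>x. w x * laplacian \<phi> x \<partial>lebesgue) = (\<integral>x. g x * \<phi> x \<partial>lebesgue)"
    using wg \<phi>_test by (simp add: distr_laplacian_def lebesgue_on_UNIV_eq)
  finally have fg: "(\<integral>x. f x * \<phi> x \<partial>lebesgue) = (\<integral>x. g x * \<phi> x \<partial>lebesgue)" .
  have \<phi>c: "continuous_on UNIV \<phi>" using \<phi>_test(2) unfolding test_fun_def smooth_on_def
    by (metis (mono_tags, lifting) Ck_on.simps(1) mem_Collect_eq)
  have int: "integrable lborel (\<lambda>x. k x * \<phi> x)" if "continuous_on \<Omega> k" for k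
  proof -
    have "continuous_on (cball x0 \<rho>) (\<lambda>x. k x * \<phi> x)"
      using \<rho> by (intro continuous_on_mult continuous_on_subset[OF that] continuous_on_subset[OF \<phi>c]) auto
    then have "integrable lborel (\<lambda>x. indicat_real (cball x0 \<rho>) x *\<^sub>R (k x * \<phi> x))"
      by (intro borel_integrable_compact) auto
    moreover have "(\<lambda>x. indicat_real (cball x0 \<rho>) x *\<^sub>R (k x * \<phi> x)) = (\<lambda>x. k x * \<phi> x)"
      using \<phi>0 by (auto simp: indicator_def fun_eq_iff)
    ultimately show ?thesis by simp
  qed
  have gc: "continuous_on \<Omega> g" using g by (rule continuous_on_subset) auto
  have "(\<integral>x. h x * \<phi> x \<partial>lborel) = (\<integral>x. s * (f x * \<phi> x) - s * (g x * \<phi> x) \<partial>lborel)"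
    by (intro Bochner_Integration.integral_cong) (auto simp: h_def algebra_simps)
  also have "\<dots> = s * (\<integral>x. f x * \<phi> x \<partial>lborel) - s * (\<integral>x. g x * \<phi> x \<partial>lborel)"
    using int[OF f] int[OF gc] by simp
  also have "\<dots> = 0"
    using fg borel_measurable_integrable[OF int[OF f]] borel_measurable_integrable[OF int[OF gc]]
    by (simp add: integral_completion)
  finally have "(\<integral>x. h x * \<phi> x \<partial>lborel) = 0" .
  moreover have "0 \<le> h x * \<phi> x" for x
  proof (cases "x \<in> ball x0 \<rho>")
    case True
    then have "h x > 0" using \<rho>(2) by force
    then show ?thesis using \<phi>pos[OF True] by simp
  qed (simp add: \<phi>0)
  ultimately have "AE x in lborel. h x * \<phi> x = 0"
    using integral_nonneg_eq_0_iff_AE[OF int[OF hc]] by simp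
  then have "AE x in lborel. x \<notin> ball x0 \<rho>"
  proof eventually_elim
    case (elim x)
    show ?case
    proof
      assume x: "x \<in> ball x0 \<rho>"
      then have "h x > 0" using \<rho>(2) by force
      with elim \<phi>pos[OF x] show False by simp
    qed
  qed
  then have "ball x0 \<rho> \<in> null_sets lborel" by (subst AE_iff_null_sets) auto
  then have "negligible (ball x0 \<rho>)" using null_sets_completionI negligible_iff_null_sets by blast
  then show False using open_not_negligible[of "ball x0 \<rho>"] \<rho> by simp
qed

lemma continuous_agree_on_closure:
  fixes f g :: "'a::metric_space \<Rightarrow> 'b::t2_space"
  assumes "continuous_on (closure \<Omega>) f" "continuous_on (closure \<Omega>) g" "\<And>x. x \<in> \<Omega> \<Longrightarrow> f x = g x"
    and x: "x \<in> closure \<Omega>"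
  shows "f x = g x"
proof -
  obtain X where X: "\<And>n. X n \<in> \<Omega>" "X \<longlonglongrightarrow> x" using x closure_sequential by metis
  have m: "\<forall>\<^sub>F n in sequentially. X n \<in> closure \<Omega>" using X(1) closure_subset by (auto intro!: always_eventually)
  have "(\<lambda>n. f (X n)) \<longlonglongrightarrow> f x" by (rule continuous_on_tendsto_compose[OF assms(1) X(2) x m])
  moreover have "(\<lambda>n. f (X n)) \<longlonglongrightarrow> g x"
    using continuous_on_tendsto_compose[OF assms(2) X(2) x m] X(1) assms(3) by simp
  ultimately show ?thesis by (rule LIMSEQ_unique)
qed

section \<open>Embedding of the continuous functions on the closure\<close>

lemma C_0_bounded:
  assumes "u \<in> C_0"
  obtains C where "\<And>x. \<bar>u x\<bar> \<le> C"
proof -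
  have c: "continuous_on UNIV u" and l: "(u \<longlongrightarrow> 0) at_infinity" using assms by (auto simp: C_0_def)
  from l have "\<forall>\<^sub>F x in at_infinity. dist (u x) 0 < 1" by (rule tendstoD) simp
  then obtain b where b: "\<And>x. b \<le> norm x \<Longrightarrow> \<bar>u x\<bar> < 1" by (auto simp: eventually_at_infinity)
  have "compact (u ` cball 0 b)"
    by (intro compact_continuous_image continuous_on_subset[OF c]) auto
  from compact_imp_bounded[OF this]
  obtain B where B: "\<forall>x\<in>cball 0 b. \<bar>u x\<bar> \<le> B"
    by (auto simp: bounded_iff simp del: mem_cball)
  have "\<bar>u x\<bar> \<le> max 1 B" for x
    using b[of x] bspec[OF B, of x] by (cases "b \<le> norm x") (auto simp: mem_cball_0 simp del: mem_cball)
  then show ?thesis by (rule that)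
qed

lemma sup_norm_le: "(\<And>x. \<bar>u x\<bar> \<le> B) \<Longrightarrow> sup_norm u \<le> B"
  unfolding sup_norm_def by (rule cSUP_least) auto

lemma abs_le_sup_norm: "(\<And>x. \<bar>u x\<bar> \<le> B) \<Longrightarrow> \<bar>u x\<bar> \<le> sup_norm u"
  unfolding sup_norm_def by (rule cSUP_upper) (auto intro!: bdd_aboveI2[where M = B])

lemma C_closure_combination:
  "u \<in> C_closure \<Omega> \<Longrightarrow> v \<in> C_closure \<Omega> \<Longrightarrow> (\<lambda>x. a * u x + b * v x) \<in> C_closure \<Omega>"
  by (auto simp: C_closure_def intro!: continuous_intros)

lemma restriction_in_C_closure: "continuous_on UNIV u \<Longrightarrow> restriction \<Omega> u \<in> C_closure \<Omega>"
  unfolding C_closure_def restriction_def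
  by (auto intro: continuous_on_eq[OF continuous_on_subset, of UNIV u])

lemma restriction_combination:
  "restriction \<Omega> (\<lambda>x. a * u x + b * v x) = (\<lambda>x. a * restriction \<Omega> u x + b * restriction \<Omega> v x)"
  by (auto simp: restriction_def)

instance bcontfun :: (metric_space, banach) banach ..

text \<open>
  By means of the extension operator \<open>E\<close>, the space \<open>C_closure \<Omega>\<close> is embedded into the Banach
  space of bounded continuous functions on the whole space: \<open>embed\<close> is an isometry with left
  inverse \<open>restr\<close>, and \<open>lift\<close> transports operators.
\<close>

locale extension_embedding =
  fixes \<Omega> :: "'a::euclidean_space set" and E :: "('a \<Rightarrow> real) \<Rightarrow> 'a \<Rightarrow> real"
  assumes bounded_\<Omega>: "bounded \<Omega>" and E: "contractive_extension_op \<Omega> E"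
begin

lemma E_C_0: "u \<in> C_closure \<Omega> \<Longrightarrow> E u \<in> C_0"
  and E_restriction: "u \<in> C_closure \<Omega> \<Longrightarrow> restriction \<Omega> (E u) = u"
  and E_contr: "u \<in> C_closure \<Omega> \<Longrightarrow> sup_norm (E u) \<le> sup_norm u"
  and E_lin: "u \<in> C_closure \<Omega> \<Longrightarrow> v \<in> C_closure \<Omega> \<Longrightarrow> E (\<lambda>x. a * u x + b * v x) = (\<lambda>x. a * E u x + b * E v x)"
  using E unfolding contractive_extension_op_def linear_op_on_def by blast+

lemma E_continuous: "u \<in> C_closure \<Omega> \<Longrightarrow> continuous_on UNIV (E u)"
  using E_C_0 by (auto simp: C_0_def)

lemma E_bound: "u \<in> C_closure \<Omega> \<Longrightarrow> \<bar>E u x\<bar> \<le> sup_norm u"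
  using E_C_0 E_contr C_0_bounded abs_le_sup_norm order_trans by metis

lemma E_eq: "u \<in> C_closure \<Omega> \<Longrightarrow> x \<in> closure \<Omega> \<Longrightarrow> E u x = u x"
  using E_restriction[of u] by (metis restriction_def)

definition embed :: "('a \<Rightarrow> real) \<Rightarrow> 'a \<Rightarrow>\<^sub>C real" where
  "embed u = Bcontfun (E u)"

definition restr :: "('a \<Rightarrow>\<^sub>C real) \<Rightarrow> 'a \<Rightarrow> real" where
  "restr f = restriction \<Omega> (apply_bcontfun f)"

lemma apply_embed: "u \<in> C_closure \<Omega> \<Longrightarrow> apply_bcontfun (embed u) = E u"
  unfolding embed_def by (intro Bcontfun_inverse bcontfun_normI[where b = "sup_norm u"])
    (auto intro: E_continuous E_bound)

lemma restr_in: "restr f \<in> C_closure \<Omega>"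
  unfolding restr_def by (intro restriction_in_C_closure) auto

lemma restr_embed: "u \<in> C_closure \<Omega> \<Longrightarrow> restr (embed u) = u"
  by (simp add: restr_def apply_embed E_restriction)

lemma embed_combination:
  "u \<in> C_closure \<Omega> \<Longrightarrow> v \<in> C_closure \<Omega> \<Longrightarrow>
     embed (\<lambda>x. a * u x + b * v x) = a *\<^sub>R embed u + b *\<^sub>R embed v"
  by (rule bcontfun_eqI) (simp add: apply_embed C_closure_combination E_lin)

lemma embed_diff:
  "u \<in> C_closure \<Omega> \<Longrightarrow> v \<in> C_closure \<Omega> \<Longrightarrow> embed (\<lambda>x. u x - v x) = embed u - embed v"
  using embed_combination[of u v 1 "- 1"] by simp

lemma diff_in: "u \<in> C_closure \<Omega> \<Longrightarrow> v \<in> C_closure \<Omega> \<Longrightarrow> (\<lambda>x. u x - v x) \<in> C_closure \<Omega>"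
  using C_closure_combination[of u \<Omega> v 1 "- 1"] by simp

lemma abs_le_norm_restr: "\<bar>restr f x\<bar> \<le> norm f"
  using norm_bounded[of f x] by (auto simp: restr_def restriction_def)

lemma norm_embed:
  assumes "u \<in> C_closure \<Omega>"
  shows "norm (embed u) = sup_norm u"
proof (rule antisym)
  show "norm (embed u) \<le> sup_norm u"
    using assms by (intro norm_bound) (simp add: apply_embed E_bound)
  show "sup_norm u \<le> norm (embed u)"
    using abs_le_norm_restr[of "embed u"] assms by (intro sup_norm_le) (simp add: restr_embed)
qed

lemma quotient_in:
  "u \<in> C_closure \<Omega> \<Longrightarrow> v \<in> C_closure \<Omega> \<Longrightarrow> f \<in> C_closure \<Omega> \<Longrightarrow> (\<lambda>x. (u x - v x) / t - f x) \<in> C_closure \<Omega>"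
  using C_closure_combination[OF diff_in, of u v f "1 / t" "- 1"] by simp

lemma norm_quotient:
  assumes "u \<in> C_closure \<Omega>" "v \<in> C_closure \<Omega>" "f \<in> C_closure \<Omega>"
  shows "sup_norm (\<lambda>x. (u x - v x) / t - f x) = norm ((embed u - embed v) /\<^sub>R t - embed f)"
proof -
  have "embed (\<lambda>x. (u x - v x) / t - f x) = (embed u - embed v) /\<^sub>R t - embed f"
    using embed_combination[OF diff_in[OF assms(1,2)] assms(3), of "1 / t" "- 1"] assms
    by (simp add: embed_diff divide_inverse mult.commute[of "inverse t"])
  then show ?thesis using norm_embed[OF quotient_in[OF assms]] by metis
qed

definition lift :: "(('a \<Rightarrow> real) \<Rightarrow> 'a \<Rightarrow> real) \<Rightarrow> ('a \<Rightarrow>\<^sub>C real) \<Rightarrow> 'a \<Rightarrow>\<^sub>C real" where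
  "lift L f = embed (L (restr f))"

lemma lift_embed: "u \<in> C_closure \<Omega> \<Longrightarrow> lift L (embed u) = embed (L u)"
  by (simp add: lift_def restr_embed)

lemma norm_restr: "sup_norm (restr f) \<le> norm f"
  by (rule sup_norm_le) (rule abs_le_norm_restr)

lemma sup_norm_restr_nonneg: "0 \<le> sup_norm (restr f)"
  using norm_embed[OF restr_in, of f] norm_ge_zero by metis

lemma lift_bounded_linear:
  assumes "L ` C_closure \<Omega> \<subseteq> C_closure \<Omega>" "linear_op_on (C_closure \<Omega>) L"
    and "\<And>u. u \<in> C_closure \<Omega> \<Longrightarrow> sup_norm (L u) \<le> M * sup_norm u"
  shows "bounded_linear (lift L)"
proof -
  have in_C: "L u \<in> C_closure \<Omega>" if "u \<in> C_closure \<Omega>" for u using assms(1) that by auto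
  have comb: "lift L (a *\<^sub>R f + b *\<^sub>R g) = a *\<^sub>R lift L f + b *\<^sub>R lift L g" for a b f g
  proof -
    have "restr (a *\<^sub>R f + b *\<^sub>R g) = (\<lambda>x. a * restr f x + b * restr g x)"
      by (simp add: restr_def plus_bcontfun.rep_eq scaleR_bcontfun.rep_eq restriction_combination)
    then have "L (restr (a *\<^sub>R f + b *\<^sub>R g)) = (\<lambda>x. a * L (restr f) x + b * L (restr g) x)"
      using assms(2) restr_in by (simp add: linear_op_on_def)
    then show ?thesis by (simp add: lift_def embed_combination in_C restr_in)
  qed
  show ?thesis
  proof (rule bounded_linear_intro)
    show "lift L (f + g) = lift L f + lift L g" for f g using comb[of 1 f 1 g] by simp
    show "lift L (r *\<^sub>R f) = r *\<^sub>R lift L f" for r f using comb[of r f 0 0] by simp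
    show "norm (lift L f) \<le> norm f * \<bar>M\<bar>" for f
    proof -
      have "norm (lift L f) = sup_norm (L (restr f))" by (simp add: lift_def norm_embed in_C restr_in)
      also have "\<dots> \<le> M * sup_norm (restr f)" by (rule assms(3)[OF restr_in])
      also have "\<dots> \<le> \<bar>M\<bar> * norm f"
        by (intro mult_mono norm_restr sup_norm_restr_nonneg) auto
      finally show ?thesis by (simp add: mult.commute)
    qed
  qed
qed

text \<open>The operator \<open>R G\<^sub>0(h) E\<close>.\<close>

definition step :: "real \<Rightarrow> ('a \<Rightarrow> real) \<Rightarrow> 'a \<Rightarrow> real" where
  "step h v = restriction \<Omega> (gaussian_semigroup h (E v))"

lemma step_in:
  assumes "h \<ge> 0" "u \<in> C_closure \<Omega>"
  shows "step h u \<in> C_closure \<Omega>"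
  unfolding step_def
  by (intro restriction_in_C_closure gaussian_semigroup_continuous[of _ "sup_norm u"] E_continuous E_bound assms)

lemma step_contr:
  assumes "h \<ge> 0" "u \<in> C_closure \<Omega>"
  shows "sup_norm (step h u) \<le> sup_norm u"
proof (rule sup_norm_le)
  fix x
  have "\<bar>gaussian_semigroup h (E u) x\<bar> \<le> sup_norm u"
    by (intro gaussian_semigroup_bound E_continuous E_bound assms)
  then show "\<bar>step h u x\<bar> \<le> sup_norm u" by (auto simp: step_def restriction_def)
qed

lemma step_linear:
  assumes "h \<ge> 0"
  shows "linear_op_on (C_closure \<Omega>) (step h)"
  unfolding linear_op_on_def
proof (intro ballI allI)
  fix u v a b assume uv: "u \<in> C_closure \<Omega>" "v \<in> C_closure \<Omega>"
  have "gaussian_semigroup h (E (\<lambda>x. a * u x + b * v x))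
      = (\<lambda>x. a * gaussian_semigroup h (E u) x + b * gaussian_semigroup h (E v) x)"
    unfolding E_lin[OF uv] using uv assms
    by (intro ext gaussian_semigroup_linear[of _ "sup_norm u" _ "sup_norm v"] E_continuous E_bound)
  then show "step h (\<lambda>x. a * u x + b * v x) = (\<lambda>x. a * step h u x + b * step h v x)"
    by (simp add: step_def restriction_combination)
qed

lemma step_0: "u \<in> C_closure \<Omega> \<Longrightarrow> step 0 u = u"
  using E_restriction[of u] by (simp add: step_def gaussian_semigroup_def[abs_def])

lemma lift_step_power:
  assumes "h \<ge> 0" "u \<in> C_closure \<Omega>"
  shows "(step h ^^ n) u \<in> C_closure \<Omega> \<and> (lift (step h) ^^ n) (embed u) = embed ((step h ^^ n) u)"
  by (induction n) (auto simp: assms step_in lift_embed)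

lemma step_derivative:
  assumes op: "open \<Omega>" and v: "v \<in> C_closure \<Omega>" and f: "f \<in> C_closure \<Omega>"
    and lap: "distr_laplacian \<Omega> v f" and dom: "E v \<in> Domain laplacian_C0"
  shows "((\<lambda>h. (lift (step h) (embed v) - embed v) /\<^sub>R h) \<longlongrightarrow> embed f) (at_right 0)"
proof -
  obtain g where g: "g \<in> C_0" "distr_laplacian UNIV (E v) g"
    using dom by (auto simp: laplacian_C0_def)
  have gc: "continuous_on UNIV g" using g by (simp add: C_0_def)
  obtain C1 where C1: "\<And>x. \<bar>g x\<bar> \<le> C1" using C_0_bounded[OF g(1)] by metis
  define C where "C = max C1 (sup_norm v)"
  have gC: "\<bar>g x\<bar> \<le> C" for x using C1[of x] by (simp add: C_def)
  have EC: "\<bar>E v x\<bar> \<le> C" for x using E_bound[OF v, of x] by (simp add: C_def)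
  have fc: "continuous_on (closure \<Omega>) f" using f by (simp add: C_closure_def)
  have "f x = g x" if "x \<in> \<Omega>" for x
    by (rule distr_laplacian_unique[OF op lap g(2) _ continuous_on_subset[OF fc closure_subset] gc that])
       (use E_eq[OF v] closure_subset in auto)
  then have fg: "f x = g x" if "x \<in> closure \<Omega>" for x
    using continuous_agree_on_closure[OF fc continuous_on_subset[OF gc]] that by auto
  show ?thesis
  proof (rule tendstoI)
    fix e :: real assume e: "e > 0"
    have "bounded (closure \<Omega>)" using bounded_\<Omega> by (rule bounded_closure)
    then obtain t0 where t0: "t0 > 0" "\<And>t x. 0 < t \<Longrightarrow> t < t0 \<Longrightarrow> x \<in> closure \<Omega> \<Longrightarrow>
        \<bar>(gaussian_semigroup t (E v) x - E v x) / t - g x\<bar> \<le> e / 2"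
      using gaussian_semigroup_generator[OF E_continuous[OF v] EC gc gC g(2) _ half_gt_zero[OF e]] by metis
    have "dist ((lift (step h) (embed v) - embed v) /\<^sub>R h) (embed f) < e" if h: "0 < h" "h < t0" for h
    proof -
      have "sup_norm (\<lambda>x. (step h v x - v x) / h - f x) \<le> e / 2"
      proof (rule sup_norm_le)
        fix x
        show "\<bar>(step h v x - v x) / h - f x\<bar> \<le> e / 2"
        proof (cases "x \<in> closure \<Omega>")
          case True
          then show ?thesis using t0(2)[OF h True] by (simp add: step_def restriction_def E_eq[OF v] fg)
        next
          case False
          then show ?thesis using v f e by (simp add: step_def restriction_def C_closure_def)
        qed
      qed
      then have "norm ((embed (step h v) - embed v) /\<^sub>R h - embed f) \<le> e / 2"
        using norm_quotient[OF step_in[OF _ v] v f] h by simp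
      then show ?thesis using e by (simp add: dist_norm lift_embed v)
    qed
    then show "\<forall>\<^sub>F h in at_right 0. dist ((lift (step h) (embed v) - embed v) /\<^sub>R h) (embed f) < e"
      using t0(1) by (auto simp: eventually_at_right_field)
  qed
qed

lemma lift_semigroup:
  assumes T: "C0_semigroup (C_closure \<Omega>) T"
  shows "degenerate_semigroup (\<lambda>t. lift (T t))"
proof (rule degenerate_semigroup.intro)
  have T_in: "T t u \<in> C_closure \<Omega>" if "t \<ge> 0" "u \<in> C_closure \<Omega>" for t u
    using T that unfolding C0_semigroup_def by blast
  show "bounded_linear (lift (T t))" if t: "t \<ge> 0" for t
  proof -
    obtain M where "\<forall>u\<in>C_closure \<Omega>. sup_norm (T t u) \<le> M * sup_norm u"
      using T t unfolding C0_semigroup_def by blast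
    then show ?thesis
      using T t unfolding C0_semigroup_def by (intro lift_bounded_linear[of _ M]) blast+
  qed
  show "lift (T (s + t)) x = lift (T s) (lift (T t) x)" if "s \<ge> 0" "t \<ge> 0" for s t x
  proof -
    have "T (s + t) (restr x) = T s (T t (restr x))"
      using T that restr_in unfolding C0_semigroup_def by blast
    then show ?thesis using that by (simp add: lift_def restr_embed T_in restr_in)
  qed
  show "((\<lambda>h. lift (T h) x) \<longlongrightarrow> lift (T 0) x) (at_right 0)" for x
  proof -
    have "((\<lambda>h. sup_norm (\<lambda>y. T h (restr x) y - restr x y)) \<longlongrightarrow> 0) (at_right 0)"
      using T restr_in unfolding C0_semigroup_def by blast
    moreover have T0: "T 0 (restr x) = restr x" using T restr_in unfolding C0_semigroup_def by blast
    ultimately have "((\<lambda>h. norm (lift (T h) x - lift (T 0) x)) \<longlongrightarrow> 0) (at_right 0)"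
      by (rule_tac Lim_transform_eventually)
         (auto simp: eventually_at_right_field lift_def T_in restr_in diff_in
            norm_embed[symmetric] embed_diff intro!: exI[of _ 1])
    then show ?thesis by (rule LIM_zero_cancel[OF tendsto_norm_zero_cancel])
  qed
qed

end

theorem theorem14:
  fixes \<Omega> :: "'a::euclidean_space set"
    and \<beta> :: "'a \<Rightarrow> real"
    and T\<^sub>R :: "real \<Rightarrow> ('a \<Rightarrow> real) \<Rightarrow> 'a \<Rightarrow> real"
    and E\<^sub>\<beta> :: "('a \<Rightarrow> real) \<Rightarrow> 'a \<Rightarrow> real"
    and D :: "('a \<Rightarrow> real) set"
    and u :: "'a \<Rightarrow> real" and \<tau> :: real
  assumes "bounded \<Omega>" and "open \<Omega>" and "smooth_boundary \<Omega>"
    and "smooth_on_subset (frontier \<Omega>) \<beta>" and "\<forall>x\<in>frontier \<Omega>. \<beta> x \<ge> 0"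
    and "C0_semigroup (C_closure \<Omega>) T\<^sub>R"
    and "generator (C_closure \<Omega>) T\<^sub>R = robin_laplacian \<Omega> \<beta>"
    and "contractive_extension_op \<Omega> E\<^sub>\<beta>"
    and "operator_core (robin_laplacian \<Omega> \<beta>) D"
    and "E\<^sub>\<beta> ` D \<subseteq> Domain laplacian_C0"
    and "u \<in> C_closure \<Omega>" and "\<tau> > 0"
  shows "uniform_limit {0..\<tau>}
           (\<lambda>n t. sup_norm (\<lambda>x.
              ((\<lambda>v. restriction \<Omega> (gaussian_semigroup (t / real n) (E\<^sub>\<beta> v))) ^^ n) u x - T\<^sub>R t u x))
           (\<lambda>t. 0) sequentially"
proof -
  note T = \<open>C0_semigroup (C_closure \<Omega>) T\<^sub>R\<close> and u = \<open>u \<in> C_closure \<Omega>\<close>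
  interpret extension_embedding \<Omega> E\<^sub>\<beta> by standard fact+
  define S where "S t = lift (T\<^sub>R t)" for t
  interpret degenerate_semigroup S unfolding S_def[abs_def] by (rule lift_semigroup[OF T])
  have T_in: "T\<^sub>R t v \<in> C_closure \<Omega>" if "t \<ge> 0" "v \<in> C_closure \<Omega>" for t v
    using T that unfolding C0_semigroup_def by blast
  have T0: "T\<^sub>R 0 v = v" if "v \<in> C_closure \<Omega>" for v
    using T that unfolding C0_semigroup_def by blast
  have S0: "S 0 x = embed (restr x)" for x
    by (simp add: S_def lift_def T0 restr_in)
  have gen_D: "(restr x, restr y) \<in> robin_laplacian \<Omega> \<beta> \<and> x = embed (restr x) \<and> y = embed (restr y)"
    if xy: "(x, y) \<in> gen" for x y
  proof -
    have x: "x = embed (restr x)" using xy S0 by (simp add: gen_def)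
    have y: "y = embed (restr y)" using gen_range[OF xy] S0 by simp
    have "((\<lambda>h. (S h x - x) /\<^sub>R h) \<longlongrightarrow> y) (at_right 0)" using xy by (simp add: gen_def)
    then have "((\<lambda>h. norm ((S h x - x) /\<^sub>R h - y)) \<longlongrightarrow> 0) (at_right 0)"
      by (intro tendsto_norm_zero LIM_zero)
    then have "((\<lambda>h. sup_norm (\<lambda>z. (T\<^sub>R h (restr x) z - restr x z) / h - restr y z)) \<longlongrightarrow> 0) (at_right 0)"
    proof (rule Lim_transform_eventually)
      show "\<forall>\<^sub>F h in at_right 0. norm ((S h x - x) /\<^sub>R h - y)
          = sup_norm (\<lambda>z. (T\<^sub>R h (restr x) z - restr x z) / h - restr y z)"
      proof (intro eventually_at_rightI[of 0 1])
        fix h :: real assume "h \<in> {0<..<1}"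
        then show "norm ((S h x - x) /\<^sub>R h - y) = sup_norm (\<lambda>z. (T\<^sub>R h (restr x) z - restr x z) / h - restr y z)"
          by (subst norm_quotient) (auto simp: T_in restr_in S_def lift_def x[symmetric] y[symmetric])
      qed simp
    qed
    then have "(restr x, restr y) \<in> generator (C_closure \<Omega>) T\<^sub>R"
      by (simp add: generator_def restr_in)
    then show ?thesis using assms(7) x y by simp
  qed
  interpret chernoff S "\<lambda>h. lift (step h)"
  proof (rule chernoff.intro[OF degenerate_semigroup_axioms chernoff_axioms.intro])
    show "bounded_linear (lift (step h))" if "h > 0" for h
      using that by (intro lift_bounded_linear[of _ 1]) (auto simp: step_in step_linear step_contr)
    show "norm (lift (step h) x) \<le> norm x" if "h > 0" for h x
    proof -
      have "norm (lift (step h) x) \<le> sup_norm (restr x)"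
        using that by (simp add: lift_def norm_embed step_in restr_in step_contr)
      then show ?thesis using norm_restr order_trans by blast
    qed
    fix x y and \<epsilon> :: real assume xy: "(x, y) \<in> gen" and \<epsilon>: "\<epsilon> > 0"
    note g = gen_D[OF xy]
    obtain v f where vf: "(v, f) \<in> robin_laplacian \<Omega> \<beta>" "v \<in> D"
      "sup_norm (\<lambda>z. restr x z - v z) + sup_norm (\<lambda>z. restr y z - f z) < \<epsilon>"
      using assms(9) g \<epsilon> unfolding operator_core_def by fast
    then have in_C: "v \<in> C_closure \<Omega>" "f \<in> C_closure \<Omega>" and lap: "distr_laplacian \<Omega> v f"
      by (auto simp: robin_laplacian_def)
    have "norm (x - embed v) + norm (y - embed f) < \<epsilon>"
      using vf(3) in_C g by (simp add: norm_embed[symmetric] embed_diff diff_in restr_in)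
    moreover have "((\<lambda>h. (lift (step h) (embed v) - embed v) /\<^sub>R h) \<longlongrightarrow> embed f) (at_right 0)"
      by (rule step_derivative) (use assms in_C lap vf(2) in auto)
    ultimately show "\<exists>v w. norm (x - v) + norm (y - w) < \<epsilon> \<and>
        ((\<lambda>h. (lift (step h) v - v) /\<^sub>R h) \<longlongrightarrow> w) (at_right 0)" by blast
  qed
  show ?thesis
  proof (rule uniform_limitI)
    fix e :: real assume e: "e > 0"
    have "S 0 (embed u) = embed u" by (simp add: S0 restr_embed u)
    then have "\<forall>\<^sub>F h in at_right 0. \<forall>n. real n * h \<le> \<tau> \<longrightarrow>
        norm ((lift (step h) ^^ n) (embed u) - S (real n * h) (embed u)) < e"
      using \<open>\<tau> > 0\<close> e by (intro chernoff_formula) auto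
    then obtain h0 where h0: "h0 > 0" "\<And>h n. 0 < h \<Longrightarrow> h < h0 \<Longrightarrow> real n * h \<le> \<tau> \<Longrightarrow>
        norm ((lift (step h) ^^ n) (embed u) - S (real n * h) (embed u)) < e"
      by (auto simp: eventually_at_right_field)
    obtain N :: nat where N: "\<tau> / h0 < real N" using reals_Archimedean2 by blast
    have "dist (sup_norm (\<lambda>x. (step (t / real n) ^^ n) u x - T\<^sub>R t u x)) 0 < e"
      if n: "n \<ge> Suc N" and t: "t \<in> {0..\<tau>}" for n t
    proof -
      define h where "h = t / real n"
      have h: "h \<ge> 0" "real n * h = t" using n t by (auto simp: h_def)
      have sn: "(step h ^^ n) u \<in> C_closure \<Omega>" "(lift (step h) ^^ n) (embed u) = embed ((step h ^^ n) u)"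
        using lift_step_power[OF h(1) u] by auto
      have "sup_norm (\<lambda>x. (step h ^^ n) u x - T\<^sub>R t u x) = norm (embed ((step h ^^ n) u) - embed (T\<^sub>R t u))"
        using sn(1) t u by (simp add: norm_embed[symmetric] embed_diff diff_in T_in)
      also have "\<dots> < e"
      proof (cases "t = 0")
        \<comment> \<open>The product formula concerns \<open>h > 0\<close> only.\<close>
        case True
        then have "(step h ^^ n) u = u" by (induction n) (auto simp: h_def step_0 u)
        then show ?thesis using True e u by (simp add: T0)
      next
        case False
        have "\<tau> / h0 < real n" using N n by linarith
        then have "h < h0" using h0(1) t n by (simp add: h_def field_simps)
        moreover have "h > 0" using False t n by (simp add: h_def)
        ultimately have "norm ((lift (step h) ^^ n) (embed u) - S (real n * h) (embed u)) < e"
          using h0(2)[of h n] h(2) t by simp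
        then show ?thesis using sn(2) h(2) u by (simp add: S_def lift_embed)
      qed
      finally have "sup_norm (\<lambda>x. (step h ^^ n) u x - T\<^sub>R t u x) < e" .
      moreover have "0 \<le> sup_norm (\<lambda>x. (step h ^^ n) u x - T\<^sub>R t u x)"
        using sn(1) t u by (simp add: norm_embed[symmetric] diff_in T_in)
      ultimately show ?thesis by (simp add: h_def)
    qed
    then have "\<forall>n\<ge>Suc N. \<forall>t\<in>{0..\<tau>}. dist (sup_norm (\<lambda>x. (step (t / real n) ^^ n) u x - T\<^sub>R t u x)) 0 < e"
      by blast
    then show "\<forall>\<^sub>F n in sequentially. \<forall>t\<in>{0..\<tau>}. dist (sup_norm (\<lambda>x.
              ((\<lambda>v. restriction \<Omega> (gaussian_semigroup (t / real n) (E\<^sub>\<beta> v))) ^^ n) u x - T\<^sub>R t u x)) 0 < e"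
      unfolding step_def[abs_def] eventually_sequentially by blast
  qed
qed

end
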